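(* Let $f,g\in L^1(\mathbb{R})\cap L^2(\mathbb{R})$ be real-valued, and let $\psi$ be a wavelet which satisfies the linear independence condition and whose Fourier transform $\widehat{\psi}$ has compact support. Then $$Sf=Sg\ \text{ on } (0,\infty)\quad\Longleftrightarrow\quad Pf=Pg\ \text{ (almost everywhere on } \mathbb{R}).$$
   Context: Fourier transform: $\widehat f(\omega)=\int_{\mathbb{R}} f(x)e^{-ix\omega}\,dx$. Power spectrum: $(Pf)(\omega)=|\widehat f(\omega)|^2$. Wavelet: $\psi\in L^1(\mathbb{R})\cap L^2(\mathbb{R})$ (real- or complex-valued) with $\int\psi(x)\,dx=0$, $\|\psi\|_2=1$ and $\int |\widehat\psi(\omega)|^2/|\omega|\,d\omega<\infty$. For $\lambda>0$, $\psi_\lambda(x)=\lambda^{1/2}\psi(\lambda x)$, so $|\widehat\psi_\lambda(\omega)|^2=\lambda^{-1}|\widehat\psi(\omega/\lambda)|^2$. Wavelet invariants: $(Sf)(\lambda)=\|f*\psi_\lambda\|_2^2=\frac1{2\pi}\int|\widehat f(\omega)|^2|\widehat\psi_\lambda(\omega)|^2\,d\omega$ for $\lambda\in(0,\infty)$. Linear independence condition on $\psi$: put $|\widehat\psi_\lambda^+(\omega)|^2:=\left(|\widehat\psi_\lambda(\omega)|^2+|\widehat\psi_\lambda(-\omega)|^2\right)\mathbf 1(\omega\ge 0)$. The condition holds if for every finite sequence $\omega_1,\dots,\omega_n$ of distinct positive frequencies, the functions $\lambda\mapsto|\widehat\psi_\lambda^+(\omega_i)|^2$ ($1\le i\le n$)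 on $(0,\infty)$ are linearly independent. *)

theory Defs
  imports "HOL-Analysis.Analysis"
begin

definition L1_L2 :: "(real \<Rightarrow> 'a::{banach, second_countable_topology}) \<Rightarrow> bool" where
  "L1_L2 f \<longleftrightarrow> integrable lebesgue f \<and> integrable lebesgue (\<lambda>x. (norm (f x))\<^sup>2)"

text \<open>The library integral of a non-integrable function is 0, so this is the usual norm only
  for functions in L2. It is used below for functions in L2 only: the convolution of an L2
  function with an L1 function is in L2.\<close>

definition L2_norm :: "(real \<Rightarrow> complex) \<Rightarrow> real" where
  "L2_norm h = sqrt (LINT x|lebesgue. (norm (h x))\<^sup>2)"

definition convolve :: "(real \<Rightarrow> complex) \<Rightarrow> (real \<Rightarrow> complex) \<Rightarrow> real \<Rightarrow> complex" where
  "convolve f h x = (LINT y|lebesgue. f y * h (x - y))"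

definition fourier :: "(real \<Rightarrow> complex) \<Rightarrow> real \<Rightarrow> complex" where
  "fourier f \<omega> = (LINT x|lebesgue. f x * exp (- (\<i> * complex_of_real (x * \<omega>))))"

definition power_spectrum :: "(real \<Rightarrow> complex) \<Rightarrow> real \<Rightarrow> real" where
  "power_spectrum f \<omega> = (norm (fourier f \<omega>))\<^sup>2"

text \<open>In the admissibility condition the integrand takes the value 0 at the origin, which is
  a null set.\<close>

definition wavelet :: "(real \<Rightarrow> complex) \<Rightarrow> bool" where
  "wavelet \<psi> \<longleftrightarrow> L1_L2 \<psi> \<and> (LINT x|lebesgue. \<psi> x) = 0 \<and> L2_norm \<psi> = 1 \<and>
     integrable lebesgue (\<lambda>\<omega>. (norm (fourier \<psi> \<omega>))\<^sup>2 / \<bar>\<omega>\<bar>)"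

definition dilate :: "(real \<Rightarrow> complex) \<Rightarrow> real \<Rightarrow> real \<Rightarrow> complex" where
  "dilate \<psi> s x = complex_of_real (sqrt s) * \<psi> (s * x)"

definition wavelet_invariant :: "(real \<Rightarrow> complex) \<Rightarrow> (real \<Rightarrow> complex) \<Rightarrow> real \<Rightarrow> real" where
  "wavelet_invariant \<psi> f s = (L2_norm (convolve f (dilate \<psi> s)))\<^sup>2"

definition folded_spectrum :: "(real \<Rightarrow> complex) \<Rightarrow> real \<Rightarrow> real \<Rightarrow> real" where
  "folded_spectrum \<psi> s \<omega> =
     (power_spectrum (dilate \<psi> s) \<omega> + power_spectrum (dilate \<psi> s) (- \<omega>)) * indicator {0..} \<omega>"

text \<open>Linear independence of the functions of the scale \<open>s\<close> on the positive half-line is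
  spelled out for an indexed family.\<close>

definition linear_independence_condition :: "(real \<Rightarrow> complex) \<Rightarrow> bool" where
  "linear_independence_condition \<psi> \<longleftrightarrow>
     (\<forall>(n::nat) \<omega>::nat \<Rightarrow> real. inj_on \<omega> {..<n} \<and> (\<forall>i<n. 0 < \<omega> i) \<longrightarrow>
       (\<forall>c::nat \<Rightarrow> real.
          (\<forall>s>0. (\<Sum>i<n. c i * folded_spectrum \<psi> s (\<omega> i)) = 0) \<longrightarrow> (\<forall>i<n. c i = 0)))"

end

theory Submission
  imports Defs "HOL-Probability.Characteristic_Functions" "HOL-Probability.Sinc_Integral"
    "HOL-Complex_Analysis.Conformal_Mappings"
begin

text \<open>By Plancherel's theorem \<open>(Sf)(s) = (2 \<pi> s)\<^sup>-\<^sup>1 \<integral> (Pf)(\<omega>) (P\<psi>)(\<omega>/s) d\<omega>\<close>, so equality of the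
  power spectra gives equality of the invariants. Conversely, \<open>h = Pf - Pg\<close> is even, continuous and
  integrable, and its multiplicative convolution on the half-line with
  \<open>\<phi>(\<omega>) = (P\<psi>)(\<omega>) + (P\<psi>)(-\<omega>)\<close> vanishes. The substitution \<open>\<omega> = e\<^sup>x\<close> turns this into an ordinary
  convolution of two integrable functions. Since \<open>\<phi>\<close> has bounded support, the Fourier transform of
  the factor made from \<open>\<phi>\<close> is holomorphic near the real line; it is not identically zero because of
  the case \<open>n = 1\<close> of linear independence, so its real zeros are isolated and the transform of the
  factor made from \<open>h\<close> has to vanish.\<close>

section \<open>Fourier transforms of integrable functions\<close>

text \<open>The weights make the exponential substitution work. Near frequency 0 both
  \<open>h\<close> and \<open>\<phi>\<close> are only known to be bounded, so
  \<open>h (exp x)\<close> alone need not decay as \<open>x\<close> tends to minus infinity, and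
  integrability of \<open>h\<close> controls only \<open>h (exp x) * exp x\<close>. The Jacobian
  \<open>exp x\<close> is therefore shared, half of the exponent going to each factor. Both factors
  then decay exponentially towards low frequencies; towards high frequencies one is controlled by
  integrability of \<open>h\<close>, the other by the bounded support of \<open>\<phi>\<close>. The
  exponential decay of the second factor at both ends gives its transform a whole strip of
  holomorphy. Plancherel is applied to \<open>convolve f (dilate \<psi> s)\<close>, which is
  integrable and whose transform, a product of two square-integrable transforms, is integrable too;
  the version for such functions suffices. Square integrability of a transform comes from Gaussian
  damping and Fatou's lemma. The integrals over \<open>lebesgue\<close> are first moved to Borel
  representatives, for which the product measurability in Fubini's theorem is immediate.\<close>

lemma fourier_lborel:
  assumes "f \<in> borel_measurable borel"
  shows "fourier f \<omega> = (LINT x|lborel. f x * exp (- (\<i> * complex_of_real (x * \<omega>))))"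
proof -
  have [measurable]: "f \<in> borel_measurable borel" by fact
  show ?thesis unfolding fourier_def by (rule integral_completion) simp
qed

lemma norm_exp_minus_i_real [simp]: "norm (exp (- (\<i> * complex_of_real x))) = 1"
  by (metis mult_minus_right norm_exp_i_times of_real_minus)

lemma norm_exp_minus_i_real' [simp]:
  "norm (exp (- (\<i> * (complex_of_real x * complex_of_real y)))) = 1"
  by (metis norm_exp_minus_i_real of_real_mult)

lemma integrable_mult_bounded:
  fixes f g :: "'a \<Rightarrow> 'b::{real_normed_algebra,banach,second_countable_topology}"
  assumes "integrable M f" "g \<in> borel_measurable M" "\<And>x. norm (g x) \<le> B"
  shows "integrable M (\<lambda>x. f x * g x)"
proof (rule Bochner_Integration.integrable_bound)
  show "integrable M (\<lambda>x. norm (f x) * B)" using assms(1) by simp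
  show "(\<lambda>x. f x * g x) \<in> borel_measurable M"
    by (rule borel_measurable_times[OF borel_measurable_integrable[OF assms(1)] assms(2)])
  have "norm (f x * g x) \<le> norm (norm (f x) * B)" for x
  proof -
    have "norm (f x * g x) \<le> norm (f x) * norm (g x)" by (rule norm_mult_ineq)
    also have "\<dots> \<le> norm (f x) * B" by (intro mult_left_mono assms) simp
    finally show ?thesis by simp
  qed
  then show "AE x in M. norm (f x * g x) \<le> norm (norm (f x) * B)" by simp
qed

lemma norm_fourier_le:
  assumes "integrable lborel f"
  shows "norm (fourier f \<omega>) \<le> (LINT x|lborel. norm (f x))"
proof -
  have "f \<in> borel_measurable borel" using borel_measurable_integrable[OF assms] by simp
  then have "norm (fourier f \<omega>) \<le> (LINT x|lborel. norm (f x * exp (- (\<i> * complex_of_real (x * \<omega>)))))"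
    using integral_norm_bound by (simp only: fourier_lborel)
  then show ?thesis by (simp add: norm_mult)
qed

lemma continuous_fourier:
  assumes "integrable lborel f"
  shows "continuous_on UNIV (fourier f)"
proof -
  have m[measurable]: "f \<in> borel_measurable borel" using borel_measurable_integrable[OF assms] by simp
  have "isCont (fourier f) \<omega>" for \<omega>
    unfolding continuous_at_sequentially comp_def
  proof (intro allI impI)
    fix u assume u: "u \<longlonglongrightarrow> \<omega>"
    show "(\<lambda>n. fourier f (u n)) \<longlonglongrightarrow> fourier f \<omega>"
      unfolding fourier_lborel[OF m]
    proof (rule integral_dominated_convergence[where w="\<lambda>x. norm (f x)"])
      show "AE x in lborel. (\<lambda>n. f x * exp (- (\<i> * complex_of_real (x * u n))))
          \<longlonglongrightarrow> f x * exp (- (\<i> * complex_of_real (x * \<omega>)))"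
        using u by (intro AE_I2 tendsto_intros)
    qed (auto simp: norm_mult assms)
  qed
  then show ?thesis by (simp add: continuous_on_eq_continuous_at)
qed

lemma borel_measurable_fourier:
  "integrable lborel f \<Longrightarrow> fourier f \<in> borel_measurable borel"
  by (intro borel_measurable_continuous_onI continuous_fourier)

text \<open>Supplies the Fubini hypothesis when the kernel \<open>k\<close> is a phase of modulus 1
  or a bounded Gaussian: integrability is inherited from the tensor product of \<open>f\<close> and
  \<open>g\<close>.\<close>

lemma integrable_tensor_bounded:
  fixes f g :: "real \<Rightarrow> 'b::{real_normed_field,banach,second_countable_topology}"
  assumes f: "integrable lborel f" and g: "integrable lborel g"
    and k: "case_prod k \<in> borel_measurable (lborel \<Otimes>\<^sub>M lborel)" and B: "\<And>x y. norm (k x y) \<le> B"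
  shows "integrable (lborel \<Otimes>\<^sub>M lborel) (\<lambda>(x, y). f x * g y * k x y)"
proof -
  have [measurable]: "f \<in> borel_measurable borel" "g \<in> borel_measurable borel"
    using f g borel_measurable_integrable by auto
  have "integrable (lborel \<Otimes>\<^sub>M lborel) (\<lambda>(x, y). f x * g y)"
  proof (rule lborel_pair.Fubini_integrable)
    show "integrable lborel (\<lambda>x. LINT y|lborel. norm (case (x, y) of (x, y) \<Rightarrow> f x * g y))"
      using f by (auto simp: norm_mult)
    show "AE x in lborel. integrable lborel (\<lambda>y. case (x, y) of (x, y) \<Rightarrow> f x * g y)"
      using g by simp
  qed simp
  then have "integrable (lborel \<Otimes>\<^sub>M lborel) (\<lambda>p. (case p of (x, y) \<Rightarrow> f x * g y) * case_prod k p)"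
    using k B by (intro integrable_mult_bounded[where B=B]) auto
  then show ?thesis by (simp add: case_prod_unfold)
qed

text \<open>The phase is symmetric in its two variables, so Fubini moves the transform from one
  factor to the other. Gaussian smoothing, Plancherel and the L2 estimate all come from this
  identity by a choice of \<open>k\<close>.\<close>

lemma fourier_multiplication:
  assumes f: "integrable lborel f" and k: "integrable lborel k"
  shows "(LINT \<omega>|lborel. fourier f \<omega> * k \<omega>) = (LINT x|lborel. f x * fourier k x)"
proof -
  have m[measurable]: "f \<in> borel_measurable borel" "k \<in> borel_measurable borel"
    using f k borel_measurable_integrable by auto
  let ?e = "\<lambda>x \<omega>. exp (- (\<i> * complex_of_real (x * \<omega>)))"
  have int: "integrable (lborel \<Otimes>\<^sub>M lborel) (\<lambda>(x, \<omega>). f x * k \<omega> * ?e x \<omega>)"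
    using f k by (intro integrable_tensor_bounded[where B=1]) auto
  have "(LINT \<omega>|lborel. fourier f \<omega> * k \<omega>) = (LINT \<omega>|lborel. LINT x|lborel. f x * k \<omega> * ?e x \<omega>)"
    unfolding fourier_lborel[OF m(1)] by (subst integral_mult_left_zero[symmetric]) (simp add: mult_ac)
  also have "\<dots> = (LINT x|lborel. LINT \<omega>|lborel. f x * k \<omega> * ?e x \<omega>)"
    by (rule lborel_pair.Fubini_integral[OF int])
  also have "\<dots> = (LINT x|lborel. f x * fourier k x)"
    unfolding fourier_lborel[OF m(2)] by (subst integral_mult_right_zero[symmetric]) (simp add: mult_ac)
  finally show ?thesis .
qed

lemma fourier_scale:
  assumes [measurable]: "f \<in> borel_measurable borel" and c: "c > 0"
  shows "fourier (\<lambda>x. f (c * x)) \<omega> = fourier f (\<omega> / c) / c"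
proof -
  have "fourier f (\<omega> / c) = c *\<^sub>R (LINT x|lborel. f (c * x) * exp (- (\<i> * complex_of_real (c * x * (\<omega> / c)))))"
    using c by (subst fourier_lborel, simp, subst lborel_integral_real_affine[where c=c and t=0]) auto
  also have "\<dots> = c *\<^sub>R fourier (\<lambda>x. f (c * x)) \<omega>"
    using c by (subst fourier_lborel) auto
  finally show ?thesis using c by (simp add: scaleR_conv_of_real)
qed

lemma fourier_modulate:
  assumes [measurable]: "f \<in> borel_measurable borel"
  shows "fourier (\<lambda>x. f x * exp (\<i> * complex_of_real (t * x))) \<omega> = fourier f (\<omega> - t)"
  by (subst (1 2) fourier_lborel)
     (auto intro!: Bochner_Integration.integral_cong simp: algebra_simps simp flip: exp_add exp_diff)

section \<open>Gaussians and Gaussian smoothing\<close>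

lemma integrable_gauss: "integrable lborel (\<lambda>x. exp (- x\<^sup>2 / 2) :: real)"
  and integral_gauss: "(LINT x|lborel. exp (- x\<^sup>2 / 2)) = sqrt (2 * pi)"
proof -
  have "integrable lborel (\<lambda>x. sqrt (2*pi) * std_normal_density x)"
    by (intro integrable_mult_right) (rule integrable_normal_density, simp)
  then show "integrable lborel (\<lambda>x. exp (- x\<^sup>2 / 2) :: real)"
    by (simp add: std_normal_density_def)
  have "(LINT x|lborel. sqrt (2*pi) * std_normal_density x) = sqrt (2*pi)"
    by (subst integral_mult_right_zero) (simp add: integral_normal_density)
  then show "(LINT x|lborel. exp (- x\<^sup>2 / 2)) = sqrt (2 * pi)"
    by (simp add: std_normal_density_def)
qed

text \<open>The Gaussian is a multiple of the standard normal density, so its transform is the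
  characteristic function, taken at \<open>-\<omega>\<close> because the phase has the opposite
  sign.\<close>

lemma fourier_gauss:
  "fourier (\<lambda>x. complex_of_real (exp (- x\<^sup>2 / 2))) \<omega> = complex_of_real (sqrt (2 * pi) * exp (- \<omega>\<^sup>2 / 2))"
proof -
  have "complex_of_real (exp (- \<omega>\<^sup>2 / 2)) = (LINT x|std_normal_distribution. iexp (- \<omega> * x))"
    using fun_cong[OF char_std_normal_distribution, of "-\<omega>"] by (simp add: char_def)
  also have "\<dots> = (LINT x|lborel. std_normal_density x *\<^sub>R iexp (- \<omega> * x))"
    by (rule integral_density) auto
  also have "\<dots> = (LINT x|lborel. complex_of_real (1 / sqrt (2*pi)) *
      (complex_of_real (exp (- x\<^sup>2 / 2)) * exp (- (\<i> * complex_of_real (x * \<omega>)))))"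
    by (intro Bochner_Integration.integral_cong)
       (auto simp: std_normal_density_def scaleR_conv_of_real mult_ac)
  also have "\<dots> = complex_of_real (1 / sqrt (2*pi)) * fourier (\<lambda>x. complex_of_real (exp (- x\<^sup>2 / 2))) \<omega>"
    by (subst integral_mult_right_zero, subst fourier_lborel) auto
  finally show ?thesis by (simp add: field_simps)
qed

lemma integrable_gauss_scaled: "c > 0 \<Longrightarrow> integrable lborel (\<lambda>x. exp (- (x / c)\<^sup>2 / 2) :: real)"
  using lborel_integrable_real_affine[OF integrable_gauss, of "1/c" 0] by simp

text \<open>Width \<open>c\<close> in frequency becomes width \<open>1 / c\<close> in
  \<open>x\<close>, and modulation recentres at \<open>t\<close>. The result is a bump whose
  integral is 2 pi for every \<open>c\<close>.\<close>

lemma fourier_modulated_gauss: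
  assumes c: "c > 0"
  shows "fourier (\<lambda>\<omega>. complex_of_real (exp (- (\<omega> / c)\<^sup>2 / 2)) * exp (\<i> * complex_of_real (t * \<omega>))) x =
    complex_of_real (sqrt (2 * pi) * c * exp (- (c * (x - t))\<^sup>2 / 2))"
proof -
  have "fourier (\<lambda>\<omega>. complex_of_real (exp (- (\<omega> / c)\<^sup>2 / 2))) y =
      complex_of_real (sqrt (2 * pi) * c * exp (- (c * y)\<^sup>2 / 2))" for y
    using fourier_scale[of "\<lambda>x. complex_of_real (exp (- x\<^sup>2 / 2))" "1/c" y] fourier_gauss[of "c * y"] c
    by (simp add: mult_ac)
  then show ?thesis by (subst fourier_modulate) auto
qed

text \<open>The left side is the inversion integral at \<open>t\<close> with a Gaussian cutoff of
  width \<open>c\<close>; the right side identifies it with an average of \<open>f\<close> around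
  \<open>t\<close>.\<close>

lemma fourier_gauss_smoothing:
  assumes "integrable lborel f" and c: "c > 0"
  shows "(LINT \<omega>|lborel. fourier f \<omega> * (complex_of_real (exp (- (\<omega> / c)\<^sup>2 / 2)) * exp (\<i> * complex_of_real (t * \<omega>)))) =
    (LINT x|lborel. f x * complex_of_real (sqrt (2 * pi) * c * exp (- (c * (x - t))\<^sup>2 / 2)))"
proof -
  have "integrable lborel (\<lambda>\<omega>. complex_of_real (exp (- (\<omega> / c)\<^sup>2 / 2)) * exp (\<i> * complex_of_real (t * \<omega>)))"
    using integrable_gauss_scaled[OF c]
    by (intro integrable_mult_bounded[where B=1] integrable_of_real) (auto simp del: of_real_mult)
  from fourier_multiplication[OF assms(1) this] show ?thesis
    by (simp only: fourier_modulated_gauss[OF c])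
qed

section \<open>Fourier inversion\<close>

text \<open>The positive and negative parts of \<open>f\<close> are densities of two finite
  measures. These agree on all rays, hence everywhere, and densities are unique almost
  everywhere.\<close>

lemma AE_eq_0_of_integral_intervals_real:
  fixes f :: "real \<Rightarrow> real"
  assumes f: "integrable lborel f"
    and zero: "\<And>a. (LINT x|lborel. indicator {a<..} x * f x) = 0"
  shows "AE x in lborel. f x = 0"
proof -
  have [measurable]: "f \<in> borel_measurable borel" using borel_measurable_integrable[OF f] by simp
  let ?p = "\<lambda>x. ennreal (max 0 (f x))" and ?n = "\<lambda>x. ennreal (max 0 (- f x))"
  have int: "integrable lborel (\<lambda>x. max 0 (f x))" "integrable lborel (\<lambda>x. max 0 (- f x))"
    using f by auto
  have em: "emeasure (density lborel (\<lambda>x. ennreal (max 0 (g x)))) {a<..} =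
      ennreal (LINT x|lborel. indicator {a<..} x * max 0 (g x))"
    if g: "integrable lborel g" for g :: "real \<Rightarrow> real" and a
  proof -
    have [measurable]: "g \<in> borel_measurable borel" using borel_measurable_integrable[OF g] by simp
    have i: "integrable lborel (\<lambda>x. indicator {a<..} x * max 0 (g x))"
      using g by (intro integrable_real_mult_indicator[of _ _ "\<lambda>x. max 0 (g x)", simplified mult.commute]) auto
    have "emeasure (density lborel (\<lambda>x. ennreal (max 0 (g x)))) {a<..} =
        (\<integral>\<^sup>+x. ennreal (indicator {a<..} x * max 0 (g x)) \<partial>lborel)"
      by (subst emeasure_density) (auto intro!: nn_integral_cong split: split_indicator)
    also have "\<dots> = ennreal (LINT x|lborel. indicator {a<..} x * max 0 (g x))"
      by (rule nn_integral_eq_integral[OF i]) auto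
    finally show ?thesis .
  qed
  have "density lborel ?p = density lborel ?n"
  proof (rule measure_eqI_lessThan)
    fix a :: real
    show "emeasure (density lborel ?p) {a<..} < \<infinity>" using em[OF f] by simp
    have i: "integrable lborel (\<lambda>x. indicator {a<..} x * max 0 (f x))"
      "integrable lborel (\<lambda>x. indicator {a<..} x * max 0 (- f x))"
      using integrable_mult_indicator[OF _ int(1), of "{a<..}"]
        integrable_mult_indicator[OF _ int(2), of "{a<..}"] by simp_all
    have "(LINT x|lborel. indicator {a<..} x * max 0 (f x)) - (LINT x|lborel. indicator {a<..} x * max 0 (- f x))
       = (LINT x|lborel. indicator {a<..} x * f x)"
    proof -
      have "indicator {a<..} x * max 0 (f x) - indicator {a<..} x * max 0 (- f x) = indicator {a<..} x * f x" for x
        by (cases "f x \<ge> 0") (simp_all add: max_def indicator_def)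
      then show ?thesis
        using Bochner_Integration.integral_diff[OF i] by simp
    qed
    then show "emeasure (density lborel ?p) {a<..} = emeasure (density lborel ?n) {a<..}"
      using em[OF f] em[of "\<lambda>x. - f x"] f zero[of a] by simp
  qed auto
  then have "AE x in lborel. ?p x = ?n x"
    by (subst (asm) sigma_finite_measure.density_unique_iff[OF lborel.sigma_finite_measure_axioms]) auto
  then show ?thesis by eventually_elim (auto simp: max_def ennreal_inj split: if_splits)
qed

text \<open>Integrability is local because in the inversion theorem one of the two functions
  compared is a priori only bounded. Real and imaginary parts, cut off to growing intervals, reduce
  the claim to the real case.\<close>

lemma AE_eq_0_of_integral_intervals:
  fixes f :: "real \<Rightarrow> complex"
  assumes f: "\<And>a b. integrable lborel (\<lambda>x. indicator {a<..b} x *\<^sub>R f x)"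
    and zero: "\<And>a b. (LINT x|lborel. indicator {a<..b} x *\<^sub>R f x) = 0"
  shows "AE x in lborel. f x = 0"
proof -
  have loc: "AE x in lborel. indicator {-real n<..real n} x * T (f x) = 0"
    if T: "bounded_linear T" for T :: "complex \<Rightarrow> real" and n
  proof (rule AE_eq_0_of_integral_intervals_real)
    have eq: "indicator A x * T (f x) = T (indicator A x *\<^sub>R f x)" for A x
      using linear_scale[OF bounded_linear.linear[OF T]] by simp
    show "integrable lborel (\<lambda>x. indicator {-real n<..real n} x * T (f x))"
      unfolding eq by (intro integrable_bounded_linear[OF T] f)
    fix a :: real
    \<comment> \<open>The ray and the window meet in the possibly empty interval from
      \<open>max a (-real n)\<close> to \<open>real n\<close>.\<close>
    have "(LINT x|lborel. indicator {a<..} x * (indicator {-real n<..real n} x * T (f x))) =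
        (LINT x|lborel. T (indicator {max a (-real n)<..real n} x *\<^sub>R f x))"
      by (intro Bochner_Integration.integral_cong) (auto simp: eq[symmetric] split: split_indicator)
    also have "\<dots> = 0"
      using integral_bounded_linear[OF T f] zero linear_0[OF bounded_linear.linear[OF T]] by simp
    finally show "(LINT x|lborel. indicator {a<..} x * (indicator {-real n<..real n} x * T (f x))) = 0" .
  qed
  have "AE x in lborel. \<forall>n. indicator {-real n<..real n} x * Re (f x) = 0"
    "AE x in lborel. \<forall>n. indicator {-real n<..real n} x * Im (f x) = 0"
    unfolding AE_all_countable using loc bounded_linear_Re bounded_linear_Im by auto
  then show ?thesis
  proof eventually_elim
    case (elim x)
    obtain n where "\<bar>x\<bar> < real n" using reals_Archimedean2 by blast
    then have "x \<in> {-real n<..real n}" by auto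
    then show ?case using elim[rule_format, of n] by (simp add: complex_eq_iff)
  qed
qed

lemma tendsto_gauss_scaled: "(\<lambda>n. exp (- (x / real (Suc n))\<^sup>2 / 2) :: real) \<longlonglongrightarrow> 1"
proof -
  have "(\<lambda>n. x / real (Suc n)) \<longlonglongrightarrow> 0" by (rule LIMSEQ_Suc[OF lim_const_over_n])
  then have "(\<lambda>n. exp (- (x / real (Suc n))\<^sup>2 / 2)) \<longlonglongrightarrow> exp (- 0\<^sup>2 / 2)" by (intro tendsto_intros) auto
  then show ?thesis by simp
qed

lemma norm_gauss_kernel_le:
  assumes "c > 0"
  shows "norm (complex_of_real (sqrt (2 * pi) * c * exp (- (c * x)\<^sup>2 / 2))) \<le> sqrt (2 * pi) * c"
proof -
  have "sqrt (2 * pi) * c * exp (- (c * x)\<^sup>2 / 2) \<le> sqrt (2 * pi) * c * 1"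
    using assms by (intro mult_left_mono) auto
  moreover have "0 \<le> sqrt (2 * pi) * c * exp (- (c * x)\<^sup>2 / 2)"
    using assms by simp
  ultimately show ?thesis by (simp only: norm_of_real abs_of_nonneg mult_1_right)
qed

text \<open>The substitution \<open>x = y + u / c\<close> fixes the Gaussian and moves the scale
  into the indicator, which then converges pointwise. The endpoints are excluded because the
  indicator jumps there.\<close>

lemma tendsto_gauss_average_indicator:
  assumes "y \<noteq> a" "y \<noteq> b"
  shows "(\<lambda>n. LINT x|lborel. indicator {a<..b} x * (sqrt (2 * pi) * real (Suc n) * exp (- (real (Suc n) * (y - x))\<^sup>2 / 2)))
    \<longlonglongrightarrow> 2 * pi * indicator {a<..b} y"
proof -
  have eq: "(LINT x|lborel. indicator {a<..b} x * (sqrt (2 * pi) * c * exp (- (c * (y - x))\<^sup>2 / 2)))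
      = (LINT u|lborel. sqrt (2 * pi) * (indicator {a<..b} (y + u / c) * exp (- u\<^sup>2 / 2)))" if c: "c > 0" for c
  proof -
    have "(LINT x|lborel. indicator {a<..b} x * (sqrt (2 * pi) * c * exp (- (c * (y - x))\<^sup>2 / 2)))
      = (1 / c) *\<^sub>R (LINT u|lborel. indicator {a<..b} (y + u / c) * (sqrt (2 * pi) * c * exp (- (c * (y - (y + u / c)))\<^sup>2 / 2)))"
      using c by (subst lborel_integral_real_affine[where c="1 / c" and t=y]) simp_all
    also have "\<dots> = (LINT u|lborel. (1 / c) * (indicator {a<..b} (y + u / c) * (sqrt (2 * pi) * c * exp (- (c * (y - (y + u / c)))\<^sup>2 / 2))))"
      by (simp only: real_scaleR_def integral_mult_right_zero)
    also have "\<dots> = (LINT u|lborel. sqrt (2 * pi) * (indicator {a<..b} (y + u / c) * exp (- u\<^sup>2 / 2)))"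
      using c by (intro Bochner_Integration.integral_cong) simp_all
    finally show ?thesis .
  qed
  have "(\<lambda>n. LINT u|lborel. sqrt (2 * pi) * (indicator {a<..b} (y + u / real (Suc n)) * exp (- u\<^sup>2 / 2)))
     \<longlonglongrightarrow> (LINT u|lborel. sqrt (2 * pi) * (indicator {a<..b} y * exp (- u\<^sup>2 / 2)))"
  proof (rule integral_dominated_convergence[where w="\<lambda>u. sqrt (2 * pi) * exp (- u\<^sup>2 / 2)"])
    show "integrable lborel (\<lambda>u. sqrt (2 * pi) * exp (- u\<^sup>2 / 2))"
      using integrable_gauss by simp
    show "AE u in lborel. (\<lambda>n. sqrt (2 * pi) * (indicator {a<..b} (y + u / real (Suc n)) * exp (- u\<^sup>2 / 2)))
        \<longlonglongrightarrow> sqrt (2 * pi) * (indicator {a<..b} y * exp (- u\<^sup>2 / 2))"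
    proof (intro AE_I2 tendsto_intros)
      fix u
      have "(\<lambda>n. y + u / real (Suc n)) \<longlonglongrightarrow> y + 0"
        by (intro tendsto_intros LIMSEQ_Suc[OF lim_const_over_n])
      then have l: "(\<lambda>n. y + u / real (Suc n)) \<longlonglongrightarrow> y" by simp
      have "eventually (\<lambda>n. (a < y + u / real (Suc n)) = (a < y)) sequentially"
      proof (cases "a < y")
        case True
        then show ?thesis using order_tendstoD(1)[OF l, of a] by simp
      next
        case False
        then have "y < a" using assms by simp
        from order_tendstoD(2)[OF l this] show ?thesis
          by (rule eventually_mono) (use False in linarith)
      qed
      moreover have "eventually (\<lambda>n. (y + u / real (Suc n) \<le> b) = (y \<le> b)) sequentially"
      proof (cases "y < b")
        case True
        from order_tendstoD(2)[OF l this] show ?thesis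
          by (rule eventually_mono) (use True in linarith)
      next
        case False
        then have "b < y" using assms by simp
        from order_tendstoD(1)[OF l this] show ?thesis
          by (rule eventually_mono) (use \<open>b < y\<close> in linarith)
      qed
      ultimately have "eventually (\<lambda>n. indicator {a<..b} (y + u / real (Suc n)) = (indicator {a<..b} y :: real)) sequentially"
        by eventually_elim (simp add: indicator_def)
      then show "(\<lambda>n. indicator {a<..b} (y + u / real (Suc n)) :: real) \<longlonglongrightarrow> indicator {a<..b} y"
        by (rule tendsto_eventually)
    qed
  qed (auto split: split_indicator)
  moreover have "(LINT u|lborel. sqrt (2 * pi) * (indicator {a<..b} y * exp (- u\<^sup>2 / 2))) = 2 * pi * indicator {a<..b} y"
    by (simp only: integral_mult_right_zero integral_gauss) simp
  moreover have pos: "0 < real (Suc n)" for n by simp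
  ultimately show ?thesis unfolding eq[OF pos] by (simp only:)
qed

text \<open>The kernel is nonnegative with total mass 2 pi, so the bound is independent of
  \<open>c\<close>, \<open>y\<close> and the interval. It provides the dominating function in the
  inversion theorem.\<close>

lemma gauss_average_indicator_le:
  assumes c: "c > 0"
  shows "\<bar>LINT x|lborel. indicator {a<..b} x * (sqrt (2 * pi) * c * exp (- (c * (y - x))\<^sup>2 / 2))\<bar> \<le> 2 * pi"
proof -
  let ?G = "\<lambda>x. sqrt (2 * pi) * c * exp (- (c * (y - x))\<^sup>2 / 2)"
  have "integrable lborel (\<lambda>x. exp (- (c * y + (- c) * x)\<^sup>2 / 2) :: real)"
    using c by (intro lborel_integrable_real_affine[OF integrable_gauss]) auto
  then have G: "integrable lborel ?G" by (simp add: right_diff_distrib)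
  then have I: "integrable lborel (\<lambda>x. indicator {a<..b} x * ?G x)"
    using integrable_mult_indicator[of "{a<..b}" lborel ?G] by simp
  have "(LINT x|lborel. exp (- x\<^sup>2 / 2)) = c *\<^sub>R (LINT x|lborel. exp (- (c * y + (- c) * x)\<^sup>2 / 2))"
    using c by (subst lborel_integral_real_affine[where c="-c" and t="c*y"]) auto
  then have "c * (LINT x|lborel. exp (- (c * (y - x))\<^sup>2 / 2)) = sqrt (2 * pi)"
    unfolding integral_gauss by (simp add: right_diff_distrib)
  then have "(LINT x|lborel. ?G x) = 2 * pi"
    by (simp add: mult.assoc)
  moreover have "(LINT x|lborel. indicator {a<..b} x * ?G x) \<le> (LINT x|lborel. ?G x)"
    using c by (intro integral_mono I G) (auto split: split_indicator)
  moreover have "(LINT x|lborel. indicator {a<..b} x * ?G x) \<ge> 0"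
    using c by (intro Bochner_Integration.integral_nonneg) (auto split: split_indicator)
  ultimately show "\<bar>LINT x|lborel. indicator {a<..b} x * ?G x\<bar> \<le> 2 * pi" by simp
qed

text \<open>The damped inversion integrals \<open>S n\<close> are integrated over an interval and
  the limit is computed twice. Removing the damping under the integral gives the double transform.
  Alternatively, Fubini shifts the Gaussian average from \<open>F\<close> onto the indicator of the
  interval, so pointwise convergence is required only for averages of an indicator, not of the
  merely integrable \<open>F\<close>. Equal integrals over all intervals give equality almost
  everywhere.\<close>

theorem fourier_inversion:
  assumes F: "integrable lborel F" and FF: "integrable lborel (fourier F)"
  shows "AE x in lborel. fourier (fourier F) (- x) = complex_of_real (2 * pi) * F x"
proof -
  let ?D = "\<lambda>x. fourier (fourier F) (- x) - complex_of_real (2 * pi) * F x"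
  let ?g = "\<lambda>n \<omega>. complex_of_real (exp (- (\<omega> / real (Suc n))\<^sup>2 / 2))"
  let ?G = "\<lambda>n x y. sqrt (2 * pi) * real (Suc n) * exp (- (real (Suc n) * (y - x))\<^sup>2 / 2)"
  define S where "S n x = (LINT \<omega>|lborel. fourier F \<omega> * (?g n \<omega> * exp (\<i> * complex_of_real (x * \<omega>))))" for n x
  have m[measurable]: "F \<in> borel_measurable borel" "fourier F \<in> borel_measurable borel"
    "fourier (fourier F) \<in> borel_measurable borel"
    using F FF borel_measurable_integrable borel_measurable_fourier by auto
  have g1: "norm (?g n \<omega>) \<le> 1" for n \<omega> by simp
  have [measurable]: "S n \<in> borel_measurable borel" for n unfolding S_def by measurable
  have S_bound: "norm (S n x) \<le> (LINT \<omega>|lborel. norm (fourier F \<omega>))" for n x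
  proof -
    have "norm (S n x) \<le> (LINT \<omega>|lborel. norm (fourier F \<omega> * (?g n \<omega> * exp (\<i> * complex_of_real (x * \<omega>)))))"
      unfolding S_def by (rule integral_norm_bound)
    also have "\<dots> \<le> (LINT \<omega>|lborel. norm (fourier F \<omega>))"
    proof (rule integral_mono)
      show "integrable lborel (\<lambda>\<omega>. norm (fourier F \<omega> * (?g n \<omega> * exp (\<i> * complex_of_real (x * \<omega>)))))"
        by (intro integrable_norm integrable_mult_bounded[OF FF, of _ 1]) (auto simp: norm_mult simp del: of_real_mult)
      show "norm (fourier F \<omega> * (?g n \<omega> * exp (\<i> * complex_of_real (x * \<omega>)))) \<le> norm (fourier F \<omega>)" for \<omega>
        using mult_left_mono[OF g1[of \<omega> n], of "norm (fourier F \<omega>)"] by (simp add: norm_mult del: of_real_mult)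
    qed (use FF in simp)
    finally show ?thesis .
  qed
  have S_lim: "(\<lambda>n. S n x) \<longlonglongrightarrow> fourier (fourier F) (- x)" for x
  proof -
    have "(\<lambda>n. S n x) \<longlonglongrightarrow> (LINT \<omega>|lborel. fourier F \<omega> * (1 * exp (\<i> * complex_of_real (x * \<omega>))))"
      unfolding S_def
    proof (rule integral_dominated_convergence[where w="\<lambda>\<omega>. norm (fourier F \<omega>)"])
      show "AE \<omega> in lborel. (\<lambda>n. fourier F \<omega> * (?g n \<omega> * exp (\<i> * complex_of_real (x * \<omega>))))
          \<longlonglongrightarrow> fourier F \<omega> * (1 * exp (\<i> * complex_of_real (x * \<omega>)))"
        using tendsto_of_real[OF tendsto_gauss_scaled, where 'a=complex]
        by (intro AE_I2 tendsto_mult tendsto_const) simp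
      show "AE \<omega> in lborel. norm (fourier F \<omega> * (?g n \<omega> * exp (\<i> * complex_of_real (x * \<omega>)))) \<le> norm (fourier F \<omega>)" for n
        using mult_left_mono[OF g1] by (auto simp: norm_mult simp del: of_real_mult)
    qed (use FF in auto)
    then show ?thesis by (subst fourier_lborel) (simp_all add: mult.commute)
  qed
  have int_ind: "integrable lborel (indicator {a<..b} :: real \<Rightarrow> real)" for a b :: real
    by (cases "a \<le> b") (auto intro!: integrable_real_indicator)
  have loc: "integrable lborel (\<lambda>x. indicator {a<..b} x *\<^sub>R u x)"
    if "u \<in> borel_measurable borel" "\<And>x. norm (u x) \<le> B" for u :: "real \<Rightarrow> complex" and B and a b :: real
  proof -
    have "integrable lborel (\<lambda>x. complex_of_real (indicator {a<..b} x) * u x)"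
      using that int_ind by (intro integrable_mult_bounded[where B=B] integrable_of_real) auto
    then show ?thesis by (simp add: scaleR_conv_of_real)
  qed
  have int_P: "integrable lborel (\<lambda>x. indicator {a<..b} x *\<^sub>R fourier (fourier F) (- x))" for a b
    by (rule loc[OF _ norm_fourier_le[OF FF]]) simp
  have int_F: "integrable lborel (\<lambda>x. indicator {a<..b} x *\<^sub>R (complex_of_real (2 * pi) * F x))" for a b :: real
    using F by (intro integrable_mult_indicator) auto
  have lim_P: "(\<lambda>n. LINT x|lborel. indicator {a<..b} x *\<^sub>R S n x)
      \<longlonglongrightarrow> (LINT x|lborel. indicator {a<..b} x *\<^sub>R fourier (fourier F) (- x))" for a b :: real
  proof (rule integral_dominated_convergence[where w="\<lambda>x. indicator {a<..b} x * (LINT \<omega>|lborel. norm (fourier F \<omega>))"])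
    show "AE x in lborel. (\<lambda>n. indicator {a<..b} x *\<^sub>R S n x) \<longlonglongrightarrow> indicator {a<..b} x *\<^sub>R fourier (fourier F) (- x)"
      by (intro AE_I2 tendsto_scaleR tendsto_const S_lim)
    show "AE x in lborel. norm (indicator {a<..b} x *\<^sub>R S n x) \<le> indicator {a<..b} x * (LINT \<omega>|lborel. norm (fourier F \<omega>))" for n
      using S_bound by (intro AE_I2) (auto split: split_indicator)
  qed (auto intro: int_ind)
  have lim_F: "(\<lambda>n. LINT x|lborel. indicator {a<..b} x *\<^sub>R S n x)
      \<longlonglongrightarrow> (LINT x|lborel. indicator {a<..b} x *\<^sub>R (complex_of_real (2 * pi) * F x))" for a b :: real
  proof -
    have "(LINT x|lborel. indicator {a<..b} x *\<^sub>R S n x) =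
        (LINT y|lborel. F y * complex_of_real (LINT x|lborel. indicator {a<..b} x * ?G n x y))" for n
    proof -
      have Sn: "S n x = (LINT y|lborel. F y * complex_of_real (?G n x y))" for x
        unfolding S_def by (rule fourier_gauss_smoothing[OF F]) simp
      have "integrable (lborel \<Otimes>\<^sub>M lborel) (\<lambda>(x, y). complex_of_real (indicator {a<..b} x) * F y * complex_of_real (?G n x y))"
        using F by (intro integrable_tensor_bounded[where B="sqrt (2 * pi) * real (Suc n)"] integrable_of_real
            norm_gauss_kernel_le int_ind) auto
      note Fubini = lborel_pair.Fubini_integral[OF this]
      have "(LINT x|lborel. indicator {a<..b} x *\<^sub>R S n x) =
          (LINT x|lborel. LINT y|lborel. complex_of_real (indicator {a<..b} x) * F y * complex_of_real (?G n x y))"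
        unfolding Sn scaleR_conv_of_real integral_mult_right_zero[symmetric] by (simp only: mult.assoc)
      also have "\<dots> = (LINT y|lborel. LINT x|lborel. complex_of_real (indicator {a<..b} x) * F y * complex_of_real (?G n x y))"
        by (rule Fubini[symmetric])
      also have "\<dots> = (LINT y|lborel. LINT x|lborel. F y * complex_of_real (indicator {a<..b} x * ?G n x y))"
        by (simp only: of_real_mult mult_ac)
      also have "\<dots> = (LINT y|lborel. F y * complex_of_real (LINT x|lborel. indicator {a<..b} x * ?G n x y))"
        by (simp only: integral_mult_right_zero integral_complex_of_real)
      finally show ?thesis .
    qed
    moreover have "(\<lambda>n. LINT y|lborel. F y * complex_of_real (LINT x|lborel. indicator {a<..b} x * ?G n x y))
        \<longlonglongrightarrow> (LINT y|lborel. F y * complex_of_real (2 * pi * indicator {a<..b} y))"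
    proof (rule integral_dominated_convergence[where w="\<lambda>y. norm (F y) * (2 * pi)"])
      show "AE y in lborel. (\<lambda>n. F y * complex_of_real (LINT x|lborel. indicator {a<..b} x * ?G n x y))
          \<longlonglongrightarrow> F y * complex_of_real (2 * pi * indicator {a<..b} y)"
        \<comment> \<open>The pointwise limit is claimed off the two endpoints, which form a null
          set.\<close>
        using AE_lborel_singleton[of a] AE_lborel_singleton[of b]
        by eventually_elim (intro tendsto_mult tendsto_const tendsto_of_real tendsto_gauss_average_indicator)
      show "AE y in lborel. norm (F y * complex_of_real (LINT x|lborel. indicator {a<..b} x * ?G n x y)) \<le> norm (F y) * (2 * pi)" for n
        unfolding norm_mult norm_of_real
        by (intro AE_I2 mult_left_mono gauss_average_indicator_le) auto
    qed (use F in auto)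
    moreover have "F y * complex_of_real (2 * pi * indicator {a<..b} y) =
        indicator {a<..b} y *\<^sub>R (complex_of_real (2 * pi) * F y)" for y
      by (simp add: scaleR_conv_of_real)
    ultimately show ?thesis by (simp only:)
  qed
  have "AE x in lborel. ?D x = 0"
  proof (rule AE_eq_0_of_integral_intervals)
    fix a b :: real
    have eq: "indicator {a<..b} x *\<^sub>R ?D x = indicator {a<..b} x *\<^sub>R fourier (fourier F) (- x)
        - indicator {a<..b} x *\<^sub>R (complex_of_real (2 * pi) * F x)" for x
      by (rule scaleR_right_diff_distrib)
    show "integrable lborel (\<lambda>x. indicator {a<..b} x *\<^sub>R ?D x)"
      unfolding eq by (intro Bochner_Integration.integrable_diff int_P int_F)
    show "(LINT x|lborel. indicator {a<..b} x *\<^sub>R ?D x) = 0"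
      unfolding eq Bochner_Integration.integral_diff[OF int_P int_F]
      using LIMSEQ_unique[OF lim_P lim_F] by simp
  qed
  then show ?thesis by simp
qed

section \<open>Convolution and Plancherel's theorem\<close>

text \<open>A vanishing transform is trivially integrable, so inversion applies and its left side is
  0.\<close>

lemma fourier_eq_0_imp_AE_eq_0:
  assumes "integrable lborel F" "\<And>\<omega>. fourier F \<omega> = 0"
  shows "AE x in lborel. F x = 0"
proof -
  have F: "fourier F = (\<lambda>_. 0)" using assms(2) by blast
  have "AE x in lborel. fourier (fourier F) (- x) = complex_of_real (2 * pi) * F x"
    by (rule fourier_inversion) (simp_all add: assms(1) F)
  then show ?thesis by (simp add: F fourier_def)
qed

lemma integral_lborel_shift:
  fixes u :: "real \<Rightarrow> 'a::{banach,second_countable_topology}"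
  shows "(LINT x|lborel. u (x - y)) = (LINT x|lborel. u x)"
  using lborel_integral_real_affine[of 1 u "- y"] by (simp add: add.commute)

lemma integrable_lborel_shift:
  fixes u :: "real \<Rightarrow> 'a::{banach,second_countable_topology}"
  shows "integrable lborel u \<Longrightarrow> integrable lborel (\<lambda>x. u (x - y))"
  using lborel_integrable_real_affine[of u 1 "- y"] by (simp add: add.commute)

lemma fourier_translate:
  assumes [measurable]: "h \<in> borel_measurable borel"
  shows "fourier (\<lambda>x. h (x - y)) \<omega> = exp (- (\<i> * complex_of_real (y * \<omega>))) * fourier h \<omega>"
proof -
  have "fourier (\<lambda>x. h (x - y)) \<omega> =
      (LINT x|lborel. (\<lambda>z. exp (- (\<i> * complex_of_real (y * \<omega>))) * (h z * exp (- (\<i> * complex_of_real (z * \<omega>))))) (x - y))"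
    by (subst fourier_lborel) (auto intro!: Bochner_Integration.integral_cong simp: algebra_simps simp flip: exp_add exp_diff)
  also have "\<dots> = exp (- (\<i> * complex_of_real (y * \<omega>))) * fourier h \<omega>"
    by (subst integral_lborel_shift, subst integral_mult_right_zero, subst fourier_lborel) auto
  finally show ?thesis .
qed

text \<open>Stated over a general normed field because it serves twice: for complex convolutions,
  and for the real product of \<open>(norm (f x))\<^sup>2\<close> with a Gaussian kernel in the L2
  estimate.\<close>

lemma
  fixes f h :: "real \<Rightarrow> 'b::{real_normed_field,banach,second_countable_topology}"
  assumes f: "integrable lborel f" and h: "integrable lborel h"
  shows integrable_convolve_pair: "integrable (lborel \<Otimes>\<^sub>M lborel) (\<lambda>(y, x). f y * h (x - y))"
    and integral_convolve_pair:
      "(LINT p|(lborel \<Otimes>\<^sub>M lborel). (case p of (y, x) \<Rightarrow> f y * h (x - y))) = (LINT x|lborel. f x) * (LINT x|lborel. h x)"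
proof -
  have [measurable]: "f \<in> borel_measurable borel" "h \<in> borel_measurable borel"
    using f h borel_measurable_integrable by auto
  show int: "integrable (lborel \<Otimes>\<^sub>M lborel) (\<lambda>(y, x). f y * h (x - y))"
  proof (rule lborel_pair.Fubini_integrable)
    show "integrable lborel (\<lambda>y. LINT x|lborel. norm (case (y, x) of (y, x) \<Rightarrow> f y * h (x - y)))"
      using f integral_lborel_shift[of "\<lambda>x. norm (h x)"] by (simp add: norm_mult)
    show "AE y in lborel. integrable lborel (\<lambda>x. case (y, x) of (y, x) \<Rightarrow> f y * h (x - y))"
      using integrable_lborel_shift[OF h] by simp
  qed simp
  have "(LINT p|(lborel \<Otimes>\<^sub>M lborel). (case p of (y, x) \<Rightarrow> f y * h (x - y))) =
      (LINT y|lborel. LINT x|lborel. f y * h (x - y))"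
    by (rule lborel_pair.integral_fst[OF int, symmetric])
  then show "(LINT p|(lborel \<Otimes>\<^sub>M lborel). (case p of (y, x) \<Rightarrow> f y * h (x - y))) = (LINT x|lborel. f x) * (LINT x|lborel. h x)"
    by (simp add: integral_lborel_shift)
qed

lemma convolve_lborel:
  assumes [measurable]: "f \<in> borel_measurable borel" "h \<in> borel_measurable borel"
  shows "convolve f h x = (LINT y|lborel. f y * h (x - y))"
  unfolding convolve_def by (rule integral_completion) simp

lemma integrable_convolve:
  assumes f: "integrable lborel f" and h: "integrable lborel h"
  shows "integrable lborel (convolve f h)"
proof -
  have "f \<in> borel_measurable borel" "h \<in> borel_measurable borel"
    using f h borel_measurable_integrable by auto
  then have "convolve f h = (\<lambda>x. LINT y|lborel. f y * h (x - y))"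
    by (intro ext convolve_lborel)
  then show ?thesis
    using lborel_pair.integrable_snd[OF integrable_convolve_pair[OF f h]] by simp
qed

text \<open>By Fubini the variable \<open>x\<close> is integrated first; the translate of
  \<open>h\<close> by \<open>y\<close> contributes the phase at \<open>y\<close>, which completes
  the transform of \<open>f\<close>.\<close>

lemma fourier_convolve:
  assumes f: "integrable lborel f" and h: "integrable lborel h"
  shows "fourier (convolve f h) \<omega> = fourier f \<omega> * fourier h \<omega>"
proof -
  have m[measurable]: "f \<in> borel_measurable borel" "h \<in> borel_measurable borel"
    "convolve f h \<in> borel_measurable borel"
    using f h integrable_convolve[OF f h] borel_measurable_integrable by auto
  let ?e = "\<lambda>x. exp (- (\<i> * complex_of_real (x * \<omega>)))"
  have "integrable (lborel \<Otimes>\<^sub>M lborel) (\<lambda>p. (case p of (y, x) \<Rightarrow> f y * h (x - y)) * (case p of (y, x) \<Rightarrow> ?e x))"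
    by (intro integrable_mult_bounded[where B=1] integrable_convolve_pair[OF f h]) (auto simp: case_prod_unfold)
  then have int: "integrable (lborel \<Otimes>\<^sub>M lborel) (\<lambda>(y, x). f y * h (x - y) * ?e x)"
    by (simp add: case_prod_unfold)
  have "fourier (convolve f h) \<omega> = (LINT x|lborel. LINT y|lborel. f y * h (x - y) * ?e x)"
    by (subst fourier_lborel, simp, subst convolve_lborel, simp, simp, subst integral_mult_left_zero[symmetric], simp)
  also have "\<dots> = (LINT y|lborel. LINT x|lborel. f y * h (x - y) * ?e x)"
    by (rule lborel_pair.Fubini_integral[OF int])
  also have "\<dots> = (LINT y|lborel. f y * fourier (\<lambda>x. h (x - y)) \<omega>)"
    by (subst fourier_lborel) (simp_all only: mult.assoc integral_mult_right_zero, simp)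
  also have "\<dots> = (LINT y|lborel. f y * ?e y * fourier h \<omega>)"
    by (simp add: fourier_translate[OF m(2)] mult.assoc)
  also have "\<dots> = fourier f \<omega> * fourier h \<omega>"
    by (subst integral_mult_left_zero, subst fourier_lborel[OF m(1)]) simp
  finally show ?thesis .
qed

lemma borel_measurable_cnj [measurable]:
  "f \<in> borel_measurable M \<Longrightarrow> (\<lambda>x. cnj (f x)) \<in> borel_measurable M"
  by (intro borel_measurable_continuous_on[of cnj] continuous_intros)

lemma fourier_cnj:
  assumes [measurable]: "f \<in> borel_measurable borel"
  shows "fourier (\<lambda>x. cnj (f x)) \<omega> = cnj (fourier f (- \<omega>))"
proof -
  have "fourier (\<lambda>x. cnj (f x)) \<omega> = (LINT x|lborel. cnj (f x * exp (- (\<i> * complex_of_real (x * (- \<omega>))))))"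
    by (subst fourier_lborel) (simp_all add: exp_cnj)
  also have "\<dots> = cnj (fourier f (- \<omega>))"
    by (subst fourier_lborel) (simp_all only: Bochner_Integration.integral_cnj assms)
  finally show ?thesis .
qed

text \<open>The multiplication formula is applied with \<open>k\<close> the conjugate of
  \<open>fourier F\<close>. The transform of \<open>k\<close> at \<open>x\<close> is the conjugate
  of the double transform at \<open>-x\<close>, which inversion identifies with 2 pi times
  \<open>cnj (F x)\<close>.\<close>

theorem plancherel:
  assumes F: "integrable lborel F" and FF: "integrable lborel (fourier F)"
  shows "(LINT \<omega>|lborel. (norm (fourier F \<omega>))\<^sup>2) = 2 * pi * (LINT x|lborel. (norm (F x))\<^sup>2)"
proof -
  have [measurable]: "F \<in> borel_measurable borel" "fourier F \<in> borel_measurable borel"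
    "fourier (fourier F) \<in> borel_measurable borel"
    using F FF borel_measurable_integrable borel_measurable_fourier by auto
  have "complex_of_real (LINT \<omega>|lborel. (norm (fourier F \<omega>))\<^sup>2) = (LINT \<omega>|lborel. fourier F \<omega> * cnj (fourier F \<omega>))"
    by (simp only: complex_norm_square integral_complex_of_real[symmetric])
  also have "\<dots> = (LINT x|lborel. F x * fourier (\<lambda>\<omega>. cnj (fourier F \<omega>)) x)"
    by (rule fourier_multiplication[OF F]) (simp add: FF)
  also have "\<dots> = (LINT x|lborel. F x * cnj (fourier (fourier F) (- x)))"
    by (subst fourier_cnj) auto
  also have "\<dots> = (LINT x|lborel. complex_of_real (2 * pi) * complex_of_real ((norm (F x))\<^sup>2))"
  proof (rule integral_cong_AE)
    show "AE x in lborel. F x * cnj (fourier (fourier F) (- x)) = complex_of_real (2 * pi) * complex_of_real ((norm (F x))\<^sup>2)"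
      using fourier_inversion[OF F FF]
      by eventually_elim (simp only: complex_norm_square complex_cnj_mult complex_cnj_complex_of_real mult_ac)
  qed auto
  also have "\<dots> = complex_of_real (2 * pi * (LINT x|lborel. (norm (F x))\<^sup>2))"
    by (simp only: integral_mult_right_zero integral_complex_of_real of_real_mult)
  finally show ?thesis by (simp only: of_real_eq_iff)
qed

text \<open>The damped energy unfolds into a double integral of \<open>f x * cnj (f y)\<close>
  against a Gaussian in \<open>y - x\<close>. Bounding the product by half the sum of the squares
  leaves a kernel of mass 2 pi in either variable, hence a bound free of \<open>c\<close>.\<close>

lemma integral_fourier_sq_gauss_le:
  assumes f: "integrable lborel f" and f2: "integrable lborel (\<lambda>x. (norm (f x))\<^sup>2)" and c: "c > 0"
  shows "integrable lborel (\<lambda>\<omega>. (norm (fourier f \<omega>))\<^sup>2 * exp (- (\<omega> / c)\<^sup>2 / 2))" (is ?I)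
    and "(LINT \<omega>|lborel. (norm (fourier f \<omega>))\<^sup>2 * exp (- (\<omega> / c)\<^sup>2 / 2)) \<le> 2 * pi * (LINT x|lborel. (norm (f x))\<^sup>2)"
proof -
  let ?g = "\<lambda>\<omega>. complex_of_real (exp (- (\<omega> / c)\<^sup>2 / 2))"
  let ?G = "\<lambda>x. sqrt (2 * pi) * c * exp (- (c * x)\<^sup>2 / 2)"
  let ?K = "\<lambda>\<omega>. fourier f \<omega> * ?g \<omega>"
  define B where "B = (LINT x|lborel. norm (f x))"
  have [measurable]: "f \<in> borel_measurable borel" "fourier f \<in> borel_measurable borel"
    using f borel_measurable_integrable borel_measurable_fourier by auto
  have B: "norm (fourier f \<omega>) \<le> B" for \<omega> unfolding B_def by (rule norm_fourier_le[OF f])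
  have "integrable lborel (\<lambda>\<omega>. ?g \<omega> * fourier f \<omega>)"
    using integrable_gauss_scaled[OF c] B by (intro integrable_mult_bounded[where B=B] integrable_of_real) auto
  then have K: "integrable lborel ?K" by (simp only: mult.commute)
  have "integrable lborel (\<lambda>\<omega>. exp (- (\<omega> / c)\<^sup>2 / 2) * (norm (fourier f \<omega>))\<^sup>2)"
    using B by (intro integrable_mult_bounded[where B="B\<^sup>2"] integrable_gauss_scaled[OF c]) (auto intro!: power_mono)
  then show ?I by (simp only: mult.commute)
  have fK: "fourier ?K (- x) = (LINT y|lborel. f y * complex_of_real (?G (y - x)))" for x
  proof -
    have "fourier ?K (- x) = (LINT \<omega>|lborel. fourier f \<omega> * (?g \<omega> * exp (\<i> * complex_of_real (x * \<omega>))))"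
      by (subst fourier_lborel) (auto simp: mult_ac)
    also have "\<dots> = (LINT y|lborel. f y * complex_of_real (?G (y - x)))"
      by (rule fourier_gauss_smoothing[OF f c])
    finally show ?thesis .
  qed
  have G_int: "integrable lborel ?G"
    using lborel_integrable_real_affine[OF integrable_gauss, of c 0] c by simp
  have "(LINT x|lborel. exp (- x\<^sup>2 / 2)) = c *\<^sub>R (LINT x|lborel. exp (- (0 + c * x)\<^sup>2 / 2))"
    using c by (subst lborel_integral_real_affine[where c=c and t=0]) auto
  then have "c * (LINT x|lborel. exp (- (c * x)\<^sup>2 / 2)) = sqrt (2 * pi)"
    unfolding integral_gauss by simp
  then have G: "(LINT x|lborel. ?G x) = 2 * pi"
    by (simp add: mult.assoc)
  have G_even: "?G (x - y) = ?G (y - x)" for x y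
    by (simp add: power2_commute[of x y] power_mult_distrib)
  have int3: "integrable (lborel \<Otimes>\<^sub>M lborel) (\<lambda>(x, y). f x * cnj (f y) * complex_of_real (?G (y - x)))"
    using f c by (intro integrable_tensor_bounded[where B="sqrt (2 * pi) * c"] norm_gauss_kernel_le) auto
  \<comment> \<open>\<open>?Q\<close> and \<open>?R\<close> carry the two squares of the
    arithmetic-geometric mean bound. Exchanging the variables turns one into the other, so their
    integrals agree.\<close>
  let ?Q = "\<lambda>(x, y). (norm (f x))\<^sup>2 * ?G (y - x)"
  let ?R = "\<lambda>(x, y). (norm (f y))\<^sup>2 * ?G (x - y)"
  have Q: "integrable (lborel \<Otimes>\<^sub>M lborel) ?Q" "(LINT p|(lborel \<Otimes>\<^sub>M lborel). ?Q p) = (LINT x|lborel. (norm (f x))\<^sup>2) * (2 * pi)"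
    using integrable_convolve_pair[OF f2 G_int] integral_convolve_pair[OF f2 G_int] G by auto
  have R: "integrable (lborel \<Otimes>\<^sub>M lborel) ?R" "(LINT p|(lborel \<Otimes>\<^sub>M lborel). ?R p) = (LINT x|lborel. (norm (f x))\<^sup>2) * (2 * pi)"
    using lborel_pair.integrable_product_swap[OF Q(1)] lborel_pair.integral_product_swap[of ?Q] Q
    by (auto simp: case_prod_unfold)
  have "complex_of_real (LINT \<omega>|lborel. (norm (fourier f \<omega>))\<^sup>2 * exp (- (\<omega> / c)\<^sup>2 / 2)) =
      (LINT \<omega>|lborel. complex_of_real ((norm (fourier f \<omega>))\<^sup>2 * exp (- (\<omega> / c)\<^sup>2 / 2)))"
    by (rule integral_complex_of_real[symmetric])
  \<comment> \<open>Conjugating the damped factor \<open>?K\<close> brings the energy into the form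
    of the multiplication formula.\<close>
  also have "\<dots> = (LINT \<omega>|lborel. fourier f \<omega> * cnj (?K \<omega>))"
    by (simp only: of_real_mult complex_norm_square complex_cnj_mult complex_cnj_complex_of_real mult_ac)
  also have "\<dots> = (LINT x|lborel. f x * fourier (\<lambda>\<omega>. cnj (?K \<omega>)) x)"
    by (rule fourier_multiplication[OF f]) (use K in \<open>simp only: complex_integrable_cnj\<close>)
  also have "\<dots> = (LINT x|lborel. f x * cnj (LINT y|lborel. f y * complex_of_real (?G (y - x))))"
    by (subst fourier_cnj) (simp_all only: fK, simp)
  also have "\<dots> = (LINT x|lborel. LINT y|lborel. f x * cnj (f y) * complex_of_real (?G (y - x)))"
  proof (rule Bochner_Integration.integral_cong)
    fix x
    have "f x * cnj (LINT y|lborel. f y * complex_of_real (?G (y - x))) =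
        (LINT y|lborel. f x * cnj (f y * complex_of_real (?G (y - x))))"
      by (simp only: Bochner_Integration.integral_cnj integral_mult_right_zero)
    then show "f x * cnj (LINT y|lborel. f y * complex_of_real (?G (y - x))) =
        (LINT y|lborel. f x * cnj (f y) * complex_of_real (?G (y - x)))"
      by (simp only: complex_cnj_mult complex_cnj_complex_of_real mult.assoc)
  qed simp
  also have "\<dots> = (LINT p|(lborel \<Otimes>\<^sub>M lborel). (\<lambda>(x, y). f x * cnj (f y) * complex_of_real (?G (y - x))) p)"
    using lborel_pair.integral_fst[OF int3] by simp
  finally have eq: "complex_of_real (LINT \<omega>|lborel. (norm (fourier f \<omega>))\<^sup>2 * exp (- (\<omega> / c)\<^sup>2 / 2)) =
      (LINT p|(lborel \<Otimes>\<^sub>M lborel). (\<lambda>(x, y). f x * cnj (f y) * complex_of_real (?G (y - x))) p)" .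
  have "(LINT \<omega>|lborel. (norm (fourier f \<omega>))\<^sup>2 * exp (- (\<omega> / c)\<^sup>2 / 2)) \<le> norm (complex_of_real (LINT \<omega>|lborel. (norm (fourier f \<omega>))\<^sup>2 * exp (- (\<omega> / c)\<^sup>2 / 2)))"
    by (simp only: norm_of_real abs_ge_self)
  also have "\<dots> = norm (LINT p|(lborel \<Otimes>\<^sub>M lborel). (\<lambda>(x, y). f x * cnj (f y) * complex_of_real (?G (y - x))) p)"
    by (simp only: eq)
  also have "\<dots> \<le> (LINT p|(lborel \<Otimes>\<^sub>M lborel). norm ((\<lambda>(x, y). f x * cnj (f y) * complex_of_real (?G (y - x))) p))"
    by (rule integral_norm_bound)
  also have "\<dots> \<le> (LINT p|(lborel \<Otimes>\<^sub>M lborel). (?Q p + ?R p) / 2)"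
  proof (rule integral_mono)
    fix p :: "real \<times> real"
    obtain x y where p: "p = (x, y)" by (cases p)
    have "norm (f x * cnj (f y) * complex_of_real (?G (y - x))) = norm (f x) * norm (f y) * ?G (y - x)"
      using c by (simp add: norm_mult abs_mult)
    also have "\<dots> \<le> ((norm (f x))\<^sup>2 + (norm (f y))\<^sup>2) / 2 * ?G (y - x)"
      using c sum_squares_bound[of "norm (f x)" "norm (f y)"] by (intro mult_right_mono) auto
    also have "\<dots> = (?Q p + ?R p) / 2"
      unfolding p prod.case G_even[of x y] by (simp only: distrib_right add_divide_distrib times_divide_eq_left)
    finally show "norm ((\<lambda>(x, y). f x * cnj (f y) * complex_of_real (?G (y - x))) p) \<le> (?Q p + ?R p) / 2"
      unfolding p prod.case .
  next
    show "integrable (lborel \<Otimes>\<^sub>M lborel) (\<lambda>p. norm ((\<lambda>(x, y). f x * cnj (f y) * complex_of_real (?G (y - x))) p))"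
      by (rule integrable_norm[OF int3])
  qed (intro integrable_divide_zero Bochner_Integration.integrable_add Q(1) R(1))
  also have "\<dots> = 2 * pi * (LINT x|lborel. (norm (f x))\<^sup>2)"
    using Bochner_Integration.integral_add[OF Q(1) R(1)] Q(2) R(2) by simp
  finally show "(LINT \<omega>|lborel. (norm (fourier f \<omega>))\<^sup>2 * exp (- (\<omega> / c)\<^sup>2 / 2)) \<le> 2 * pi * (LINT x|lborel. (norm (f x))\<^sup>2)" .
qed

text \<open>Fatou's lemma as the cutoff widens: all damped energies obey the same bound, so their
  pointwise limit has finite integral.\<close>

lemma integrable_fourier_sq:
  assumes f: "integrable lborel f" and f2: "integrable lborel (\<lambda>x. (norm (f x))\<^sup>2)"
  shows "integrable lborel (\<lambda>\<omega>. (norm (fourier f \<omega>))\<^sup>2)"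
proof (rule integrableI_bounded)
  have [measurable]: "fourier f \<in> borel_measurable borel"
    using f borel_measurable_fourier by auto
  show "(\<lambda>\<omega>. (norm (fourier f \<omega>))\<^sup>2) \<in> borel_measurable lborel" by simp
  let ?g = "\<lambda>n \<omega>. (norm (fourier f \<omega>))\<^sup>2 * exp (- (\<omega> / real (Suc n))\<^sup>2 / 2)"
  let ?C = "2 * pi * (LINT x|lborel. (norm (f x))\<^sup>2)"
  have "(\<integral>\<^sup>+\<omega>. ennreal (norm ((norm (fourier f \<omega>))\<^sup>2)) \<partial>lborel) =
      (\<integral>\<^sup>+\<omega>. liminf (\<lambda>n. ennreal (?g n \<omega>)) \<partial>lborel)"
  proof (rule nn_integral_cong)
    fix \<omega>
    have "(\<lambda>n. ?g n \<omega>) \<longlonglongrightarrow> (norm (fourier f \<omega>))\<^sup>2 * 1"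
      by (intro tendsto_mult tendsto_const tendsto_gauss_scaled)
    then have "(\<lambda>n. ennreal (?g n \<omega>)) \<longlonglongrightarrow> ennreal ((norm (fourier f \<omega>))\<^sup>2 * 1)"
      by (rule tendsto_ennrealI)
    then have "liminf (\<lambda>n. ennreal (?g n \<omega>)) = ennreal ((norm (fourier f \<omega>))\<^sup>2 * 1)"
      by (intro lim_imp_Liminf) simp_all
    then show "ennreal (norm ((norm (fourier f \<omega>))\<^sup>2)) = liminf (\<lambda>n. ennreal (?g n \<omega>))"
      by simp
  qed
  also have "\<dots> \<le> liminf (\<lambda>n. \<integral>\<^sup>+\<omega>. ennreal (?g n \<omega>) \<partial>lborel)"
    by (rule nn_integral_liminf) simp
  also have "\<dots> \<le> liminf (\<lambda>n. ennreal ?C)"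
  proof (intro Liminf_mono always_eventually allI)
    fix n
    have "(\<integral>\<^sup>+\<omega>. ennreal (?g n \<omega>) \<partial>lborel) = ennreal (LINT \<omega>|lborel. ?g n \<omega>)"
      by (intro nn_integral_eq_integral integral_fourier_sq_gauss_le[OF f f2]) auto
    also have "\<dots> \<le> ennreal ?C"
      by (intro ennreal_leI integral_fourier_sq_gauss_le[OF f f2]) auto
    finally show "(\<integral>\<^sup>+\<omega>. ennreal (?g n \<omega>) \<partial>lborel) \<le> ennreal ?C" .
  qed
  also have "\<dots> < \<infinity>" by (simp add: Liminf_const)
  finally show "(\<integral>\<^sup>+\<omega>. ennreal (norm ((norm (fourier f \<omega>))\<^sup>2)) \<partial>lborel) < \<infinity>" .
qed

section \<open>Wavelet invariants in the frequency domain\<close>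

lemma lebesgue_measurable_of_AE_eq_borel:
  fixes f g :: "real \<Rightarrow> 'b::euclidean_space"
  assumes ae: "AE x in lborel. f x = g x" and g: "g \<in> borel_measurable borel"
  shows "f \<in> borel_measurable lebesgue"
proof -
  from ae obtain N where N: "N \<in> null_sets lborel" "{x. f x \<noteq> g x} \<subseteq> N"
    by (auto simp: eventually_ae_filter)
  then have N': "N \<in> null_sets lebesgue" by (intro null_sets_completionI)
  have "g \<in> borel_measurable lebesgue" using g by (intro measurable_completion) simp
  then have "g \<in> borel_measurable (lebesgue_on (- N))" by (rule measurable_restrict_space1)
  then have "f \<in> borel_measurable (lebesgue_on (- N))"
    using N(2) by (subst measurable_cong[of _ _ g]) (auto simp: space_restrict_space)
  then show ?thesis using lebesgue_measurable_diff_null[OF N'] by blast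
qed

lemma integral_lebesgue_AE_eq_borel:
  fixes f g :: "real \<Rightarrow> 'b::euclidean_space"
  assumes ae: "AE x in lborel. f x = g x" and g: "g \<in> borel_measurable borel"
  shows "integral\<^sup>L lebesgue f = integral\<^sup>L lborel g"
proof -
  have g': "g \<in> borel_measurable lborel" using g by simp
  have "integral\<^sup>L lebesgue f = integral\<^sup>L lebesgue g"
    by (intro integral_cong_AE lebesgue_measurable_of_AE_eq_borel[OF ae g]
        measurable_completion[OF g'] AE_completion ae)
  then show ?thesis using integral_completion[OF g'] by simp
qed

text \<open>The set where \<open>P\<close> fails may be non-measurable, so the argument passes to a
  Borel null set containing it.\<close>

lemma AE_lborel_affine:
  assumes "AE x in lborel. P x" and c: "c \<noteq> 0"
  shows "AE x in lborel. P (t + c * x :: real)"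
proof -
  from assms(1) obtain N where N: "N \<in> null_sets lborel" "{x. \<not> P x} \<subseteq> N"
    by (auto simp: eventually_ae_filter)
  then have [measurable]: "N \<in> sets borel" by auto
  have "AE x in lborel. x \<notin> N" using N(1) by (rule AE_not_in)
  then have "AE x in lborel. t + c * x \<notin> N"
    by (intro AE_borel_affine[of c "\<lambda>x. x \<notin> N"] c) simp_all
  then show ?thesis by eventually_elim (use N(2) in blast)
qed

text \<open>Real and imaginary parts are each replaced by a Borel function. Transforms and
  convolutions see only the class modulo null sets, so the analysis can be done on the
  representative.\<close>

lemma L1_L2_borel_representative:
  fixes f :: "real \<Rightarrow> complex"
  assumes "L1_L2 f"
  obtains f' where "f' \<in> borel_measurable borel" "AE x in lborel. f x = f' x"
    "integrable lborel f'" "integrable lborel (\<lambda>x. (norm (f' x))\<^sup>2)"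
proof -
  have int: "integrable lebesgue f" "integrable lebesgue (\<lambda>x. (norm (f x))\<^sup>2)"
    using assms by (auto simp: L1_L2_def)
  have m: "f \<in> borel_measurable lebesgue" using int(1) by (rule borel_measurable_integrable)
  obtain u v where u: "u \<in> borel_measurable lborel" "AE x in lborel. Re (f x) = u x"
    and v: "v \<in> borel_measurable lborel" "AE x in lborel. Im (f x) = v x"
    using completion_ex_borel_measurable_real[of "\<lambda>x. Re (f x)" lborel]
      completion_ex_borel_measurable_real[of "\<lambda>x. Im (f x)" lborel] m by auto
  define f' where "f' = (\<lambda>x. Complex (u x) (v x))"
  have f'_eq: "f' = (\<lambda>x. complex_of_real (u x) + \<i> * complex_of_real (v x))"
    by (simp add: f'_def Complex_eq)
  have m': "f' \<in> borel_measurable lborel"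
    using u(1) v(1) unfolding f'_eq by simp
  have ae: "AE x in lborel. f x = f' x"
    using u(2) v(2) by eventually_elim (simp add: f'_def complex_eq_iff)
  have mc: "f' \<in> borel_measurable lebesgue" by (rule measurable_completion[OF m'])
  have 1: "integrable lebesgue f'"
    using integrable_cong_AE[OF m mc AE_completion[OF ae]] int(1) by simp
  have "AE x in lebesgue. (norm (f x))\<^sup>2 = (norm (f' x))\<^sup>2"
    using AE_completion[OF ae] by eventually_elim simp
  then have 2: "integrable lebesgue (\<lambda>x. (norm (f' x))\<^sup>2)"
    using integrable_cong_AE[of "\<lambda>x. (norm (f x))\<^sup>2" lebesgue "\<lambda>x. (norm (f' x))\<^sup>2"] int(2) m mc by simp
  show ?thesis
  proof (rule that[of f'])
    show "integrable lborel f'" using 1 integrable_completion[OF m'] by simp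
    show "integrable lborel (\<lambda>x. (norm (f' x))\<^sup>2)"
      using 2 m' integrable_completion[of "\<lambda>x. (norm (f' x))\<^sup>2" lborel] by simp
  qed (use m' ae in auto)
qed

lemma fourier_cong_AE:
  assumes ae: "AE x in lborel. f x = f' x" and [measurable]: "f' \<in> borel_measurable borel"
  shows "fourier f = fourier f'"
proof
  fix \<omega>
  have "fourier f \<omega> = (LINT x|lborel. f' x * exp (- (\<i> * complex_of_real (x * \<omega>))))"
    unfolding fourier_def
  proof (rule integral_lebesgue_AE_eq_borel)
    show "AE x in lborel. f x * exp (- (\<i> * complex_of_real (x * \<omega>))) = f' x * exp (- (\<i> * complex_of_real (x * \<omega>)))"
      using ae by eventually_elim simp
  qed simp
  then show "fourier f \<omega> = fourier f' \<omega>" by (subst (2) fourier_lborel) simp_all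
qed

text \<open>For fixed \<open>x\<close> the reflection of \<open>y\<close> to \<open>x - y\<close>
  preserves null sets, so the integrands agree almost everywhere and the convolutions agree at every
  point.\<close>

lemma convolve_cong_AE:
  assumes f: "AE x in lborel. f x = f' x" and [measurable]: "f' \<in> borel_measurable borel"
    and h: "AE x in lborel. h x = h' x" and [measurable]: "h' \<in> borel_measurable borel"
  shows "convolve f h = convolve f' h'"
proof
  fix x
  have "convolve f h x = (LINT y|lborel. f' y * h' (x - y))"
    unfolding convolve_def
  proof (rule integral_lebesgue_AE_eq_borel)
    have "AE y in lborel. h (x + (- 1) * y) = h' (x + (- 1) * y)"
      using h by (rule AE_lborel_affine) simp
    then show "AE y in lborel. f y * h (x - y) = f' y * h' (x - y)"
      using f by eventually_elim simp
  qed simp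
  then show "convolve f h x = convolve f' h' x" by (subst (2) convolve_lborel) simp_all
qed

lemma fourier_dilate:
  assumes m[measurable]: "\<psi> \<in> borel_measurable borel" and s: "s > 0"
  shows "fourier (dilate \<psi> s) \<omega> = complex_of_real (1 / sqrt s) * fourier \<psi> (\<omega> / s)"
proof -
  have [measurable]: "dilate \<psi> s \<in> borel_measurable borel" unfolding dilate_def by simp
  have "fourier (dilate \<psi> s) \<omega> = complex_of_real (sqrt s) * fourier (\<lambda>x. \<psi> (s * x)) \<omega>"
    by (subst (1 2) fourier_lborel) (simp_all only: dilate_def mult.assoc integral_mult_right_zero, simp_all)
  also have "\<dots> = complex_of_real (sqrt s / s) * fourier \<psi> (\<omega> / s)"
    using fourier_scale[OF m s] by simp
  also have "sqrt s / s = 1 / sqrt s" using s by (simp add: real_div_sqrt field_simps)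
  finally show ?thesis .
qed

lemma integrable_dilate:
  assumes i: "integrable lborel \<psi>" and i2: "integrable lborel (\<lambda>x. (norm (\<psi> x))\<^sup>2)" and s: "s > 0"
  shows "integrable lborel (dilate \<psi> s)" "integrable lborel (\<lambda>x. (norm (dilate \<psi> s x))\<^sup>2)"
proof -
  show "integrable lborel (dilate \<psi> s)"
    unfolding dilate_def using lborel_integrable_real_affine[OF i, of s 0] s by simp
  show "integrable lborel (\<lambda>x. (norm (dilate \<psi> s x))\<^sup>2)"
    unfolding dilate_def using lborel_integrable_real_affine[OF i2, of s 0] s
    by (simp add: norm_mult power_mult_distrib)
qed

lemma power_spectrum_dilate:
  assumes "L1_L2 \<psi>" and s: "s > 0"
  shows "power_spectrum (dilate \<psi> s) \<omega> = power_spectrum \<psi> (\<omega> / s) / s"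
proof -
  obtain \<psi>' where \<psi>': "\<psi>' \<in> borel_measurable borel" "AE x in lborel. \<psi> x = \<psi>' x"
    using L1_L2_borel_representative[OF assms(1)] by metis
  have [measurable]: "\<psi>' \<in> borel_measurable borel" by (rule \<psi>'(1))
  have "AE x in lborel. \<psi> (0 + s * x) = \<psi>' (0 + s * x)"
    by (rule AE_lborel_affine[OF \<psi>'(2)]) (use s in simp)
  then have "AE x in lborel. dilate \<psi> s x = dilate \<psi>' s x"
    by eventually_elim (simp add: dilate_def)
  moreover have "dilate \<psi>' s \<in> borel_measurable borel" unfolding dilate_def by simp
  ultimately have "fourier (dilate \<psi> s) = fourier (dilate \<psi>' s)" by (rule fourier_cong_AE)
  moreover have "fourier \<psi> = fourier \<psi>'" using \<psi>' by (intro fourier_cong_AE)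
  ultimately show ?thesis
    using s unfolding power_spectrum_def
    by (simp add: fourier_dilate[OF \<psi>'(1) s] norm_mult norm_divide power_mult_distrib power_divide)
qed

lemma
  assumes "L1_L2 f"
  shows continuous_power_spectrum: "continuous_on UNIV (power_spectrum f)"
    and power_spectrum_bounded: "\<exists>B. \<forall>\<omega>. power_spectrum f \<omega> \<le> B"
    and integrable_power_spectrum: "integrable lborel (power_spectrum f)"
proof -
  obtain f' where f': "f' \<in> borel_measurable borel" "AE x in lborel. f x = f' x"
    "integrable lborel f'" "integrable lborel (\<lambda>x. (norm (f' x))\<^sup>2)"
    using L1_L2_borel_representative[OF assms] by metis
  have eq: "power_spectrum f = (\<lambda>\<omega>. (norm (fourier f' \<omega>))\<^sup>2)"
    using fourier_cong_AE[OF f'(2,1)] by (simp add: power_spectrum_def fun_eq_iff)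
  show "continuous_on UNIV (power_spectrum f)"
    unfolding eq by (intro continuous_intros continuous_fourier f')
  show "\<exists>B. \<forall>\<omega>. power_spectrum f \<omega> \<le> B"
    unfolding eq using norm_fourier_le[OF f'(3)]
    by (intro exI[of _ "(LINT x|lborel. norm (f' x))\<^sup>2"] allI power_mono) auto
  show "integrable lborel (power_spectrum f)"
    unfolding eq by (rule integrable_fourier_sq[OF f'(3,4)])
qed

text \<open>Plancherel for the convolution, whose transform factors. The divisor
  \<open>2 * pi\<close> is Plancherel's constant; \<open>s\<close> comes from the dilation law for
  the power spectrum.\<close>

lemma wavelet_invariant_eq:
  assumes f: "L1_L2 f" and \<psi>: "L1_L2 \<psi>" and s: "s > 0"
  shows "wavelet_invariant \<psi> f s =
    (LINT \<omega>|lborel. power_spectrum f \<omega> * power_spectrum \<psi> (\<omega> / s)) / (2 * pi * s)"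
proof -
  obtain f' where f': "f' \<in> borel_measurable borel" "AE x in lborel. f x = f' x"
    "integrable lborel f'" "integrable lborel (\<lambda>x. (norm (f' x))\<^sup>2)"
    using L1_L2_borel_representative[OF f] by metis
  obtain \<psi>' where \<psi>': "\<psi>' \<in> borel_measurable borel" "AE x in lborel. \<psi> x = \<psi>' x"
    "integrable lborel \<psi>'" "integrable lborel (\<lambda>x. (norm (\<psi>' x))\<^sup>2)"
    using L1_L2_borel_representative[OF \<psi>] by metis
  have [measurable]: "f' \<in> borel_measurable borel" "\<psi>' \<in> borel_measurable borel" by fact+
  note d = integrable_dilate[OF \<psi>'(3,4) s]
  have md[measurable]: "dilate \<psi>' s \<in> borel_measurable borel" unfolding dilate_def by simp
  have "AE x in lborel. \<psi> (0 + s * x) = \<psi>' (0 + s * x)"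
    by (rule AE_lborel_affine[OF \<psi>'(2)]) (use s in simp)
  then have ad: "AE x in lborel. dilate \<psi> s x = dilate \<psi>' s x"
    by eventually_elim (simp add: dilate_def)
  let ?F = "convolve f' (dilate \<psi>' s)"
  have conv: "convolve f (dilate \<psi> s) = ?F"
    by (rule convolve_cong_AE[OF f'(2,1) ad md])
  have F: "integrable lborel ?F" by (rule integrable_convolve[OF f'(3) d(1)])
  then have [measurable]: "?F \<in> borel_measurable borel" using borel_measurable_integrable by auto
  have fF: "fourier ?F = (\<lambda>\<omega>. fourier f' \<omega> * fourier (dilate \<psi>' s) \<omega>)"
    using fourier_convolve[OF f'(3) d(1)] by blast
  have [measurable]: "fourier f' \<in> borel_measurable borel" "fourier (dilate \<psi>' s) \<in> borel_measurable borel"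
    using borel_measurable_fourier f'(3) d(1) by auto
  \<comment> \<open>Both factors of the product are square integrable, and
    \<open>2 * a * b <= a^2 + b^2\<close> dominates the product by the sum of the squares.\<close>
  have FF: "integrable lborel (fourier ?F)"
    unfolding fF
  proof (rule Bochner_Integration.integrable_bound)
    show "integrable lborel (\<lambda>\<omega>. (norm (fourier f' \<omega>))\<^sup>2 + (norm (fourier (dilate \<psi>' s) \<omega>))\<^sup>2)"
      by (intro Bochner_Integration.integrable_add integrable_fourier_sq f'(3,4) d)
    have "norm (fourier f' \<omega> * fourier (dilate \<psi>' s) \<omega>)
        \<le> norm ((norm (fourier f' \<omega>))\<^sup>2 + (norm (fourier (dilate \<psi>' s) \<omega>))\<^sup>2)" for \<omega>
    proof -
      have "2 * (norm (fourier f' \<omega>) * norm (fourier (dilate \<psi>' s) \<omega>)) \<le>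
          (norm (fourier f' \<omega>))\<^sup>2 + (norm (fourier (dilate \<psi>' s) \<omega>))\<^sup>2"
        using sum_squares_bound[of "norm (fourier f' \<omega>)" "norm (fourier (dilate \<psi>' s) \<omega>)"] by simp
      moreover have "0 \<le> norm (fourier f' \<omega>) * norm (fourier (dilate \<psi>' s) \<omega>)" by simp
      ultimately show ?thesis unfolding norm_mult real_norm_def by linarith
    qed
    then show "AE \<omega> in lborel. norm (fourier f' \<omega> * fourier (dilate \<psi>' s) \<omega>)
        \<le> norm ((norm (fourier f' \<omega>))\<^sup>2 + (norm (fourier (dilate \<psi>' s) \<omega>))\<^sup>2)" by simp
  qed simp
  have "wavelet_invariant \<psi> f s = (LINT x|lborel. (norm (?F x))\<^sup>2)"
  proof -
    have "(LINT x|lebesgue. (norm (?F x))\<^sup>2) = (LINT x|lborel. (norm (?F x))\<^sup>2)"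
      by (rule integral_completion) simp
    then show ?thesis by (simp add: wavelet_invariant_def L2_norm_def conv)
  qed
  also have "\<dots> = (LINT \<omega>|lborel. (norm (fourier ?F \<omega>))\<^sup>2) / (2 * pi)"
    unfolding plancherel[OF F FF] by simp
  also have "(LINT \<omega>|lborel. (norm (fourier ?F \<omega>))\<^sup>2) = (LINT \<omega>|lborel. power_spectrum f \<omega> * power_spectrum \<psi> (\<omega> / s) / s)"
  proof (rule Bochner_Integration.integral_cong)
    fix \<omega>
    have "fourier f = fourier f'" "fourier (dilate \<psi> s) = fourier (dilate \<psi>' s)"
      using f' ad md by (auto intro: fourier_cong_AE)
    then have "(norm (fourier ?F \<omega>))\<^sup>2 = power_spectrum f \<omega> * power_spectrum (dilate \<psi> s) \<omega>"
      by (simp add: fF power_spectrum_def norm_mult power_mult_distrib)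
    then show "(norm (fourier ?F \<omega>))\<^sup>2 = power_spectrum f \<omega> * power_spectrum \<psi> (\<omega> / s) / s"
      by (simp add: power_spectrum_dilate[OF \<psi> s])
  qed simp
  finally show ?thesis by simp
qed

text \<open>For real \<open>f\<close>, reversing the frequency conjugates the transform and keeps
  its modulus. This is where the real-valuedness of the two signals enters.\<close>

lemma power_spectrum_even:
  fixes f :: "real \<Rightarrow> real"
  shows "power_spectrum (\<lambda>x. complex_of_real (f x)) (- \<omega>) = power_spectrum (\<lambda>x. complex_of_real (f x)) \<omega>"
proof -
  have "fourier (\<lambda>x. complex_of_real (f x)) (- \<omega>) =
      (LINT x|lebesgue. cnj (complex_of_real (f x) * exp (- (\<i> * complex_of_real (x * \<omega>)))))"
    unfolding fourier_def by (simp add: exp_cnj)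
  also have "\<dots> = cnj (fourier (\<lambda>x. complex_of_real (f x)) \<omega>)"
    unfolding fourier_def by (rule Bochner_Integration.integral_cnj)
  finally show ?thesis by (simp add: power_spectrum_def)
qed

section \<open>Multiplicative convolution\<close>

text \<open>Around a point \<open>z\<close> of the strip the exponential is expanded in powers of
  \<open>w - z\<close>. On the disc of radius \<open>b - \<bar>Im z\<bar>\<close> the absolute
  values sum to at most \<open>norm (q u) * exp (b * \<bar>u\<bar>)\<close>, so series and integral
  may be exchanged and the transform is a power series there.\<close>

lemma holomorphic_fourier_strip:
  fixes q :: "real \<Rightarrow> complex"
  assumes m[measurable]: "q \<in> borel_measurable borel"
    and q: "integrable lborel (\<lambda>u. norm (q u) * exp (b * \<bar>u\<bar>))"
  shows "(\<lambda>w. LINT u|lborel. q u * exp (- (\<i> * (complex_of_real u * w)))) holomorphic_on {z. \<bar>Im z\<bar> < b}"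
proof -
  let ?F = "\<lambda>w. LINT u|lborel. q u * exp (- (\<i> * (complex_of_real u * w)))"
  \<comment> \<open>For \<open>z\<close> outside the strip the ball is empty, so no restriction on
    \<open>z\<close> has to be carried along.\<close>
  have loc: "?F holomorphic_on ball z (b - \<bar>Im z\<bar>)" for z
  proof (rule power_series_holomorphic)
    fix w assume w: "w \<in> ball z (b - \<bar>Im z\<bar>)"
    define t where "t n u = q u * exp (- (\<i> * (complex_of_real u * z))) *
        ((- (\<i> * complex_of_real u)) ^ n /\<^sub>R fact n) * (w - z) ^ n" for n u
    \<comment> \<open>Regrouping the powers shows \<open>t n u\<close> as a term of the exponential
      series, which gives the sum of the series and that of its absolute values.\<close>
    have t_eq: "t n u = q u * exp (- (\<i> * (complex_of_real u * z))) *
        ((- (\<i> * (complex_of_real u * (w - z)))) ^ n /\<^sub>R fact n)" for n u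
    proof -
      have "(- (\<i> * (complex_of_real u * (w - z)))) ^ n = (- (\<i> * complex_of_real u)) ^ n * (w - z) ^ n"
        by (subst power_mult_distrib[symmetric]) (simp add: algebra_simps)
      then show ?thesis by (simp add: t_def)
    qed
    have norm_t: "norm (t n u) = norm (q u) * exp (u * Im z) * ((\<bar>u\<bar> * norm (w - z)) ^ n /\<^sub>R fact n)" for n u
      by (simp add: t_eq norm_mult norm_power)
    have sums_t: "(\<lambda>n. t n u) sums (q u * exp (- (\<i> * (complex_of_real u * w))))" for u
    proof -
      have "(\<lambda>n. t n u) sums (q u * exp (- (\<i> * (complex_of_real u * z))) * exp (- (\<i> * (complex_of_real u * (w - z)))))"
        unfolding t_eq by (intro sums_mult exp_converges)
      also have "q u * exp (- (\<i> * (complex_of_real u * z))) * exp (- (\<i> * (complex_of_real u * (w - z)))) =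
          q u * exp (- (\<i> * (complex_of_real u * w)))"
        by (simp add: algebra_simps flip: exp_add)
      finally show ?thesis .
    qed
    have sums_norm: "(\<lambda>n. norm (t n u)) sums (norm (q u) * exp (u * Im z) * exp (\<bar>u\<bar> * norm (w - z)))" for u
      unfolding norm_t by (intro sums_mult exp_converges)
    have bound: "norm (q u) * exp (u * Im z) * exp (\<bar>u\<bar> * norm (w - z)) \<le> norm (q u) * exp (b * \<bar>u\<bar>)" for u
    proof -
      have "norm (w - z) \<le> b - \<bar>Im z\<bar>" using w by (simp add: dist_norm norm_minus_commute)
      then have "\<bar>u\<bar> * norm (w - z) \<le> \<bar>u\<bar> * (b - \<bar>Im z\<bar>)" by (intro mult_left_mono) auto
      moreover have "u * Im z \<le> \<bar>u\<bar> * \<bar>Im z\<bar>" by (metis abs_ge_self abs_mult)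
      ultimately have "u * Im z + \<bar>u\<bar> * norm (w - z) \<le> b * \<bar>u\<bar>" by (simp add: algebra_simps)
      then show ?thesis by (simp add: mult.assoc mult_left_mono flip: exp_add)
    qed
    have partial: "(\<Sum>i<n. norm (t i u)) \<le> norm (q u) * exp (b * \<bar>u\<bar>)" for n u
      using sum_le_suminf[OF sums_summable[OF sums_norm], of "{..<n}" u] bound[of u]
      by (simp add: sums_unique[OF sums_norm, symmetric])
    have mt[measurable]: "t n \<in> borel_measurable borel" for n
      unfolding t_def by measurable
    have int_t: "integrable lborel (t n)" for n
    proof (rule Bochner_Integration.integrable_bound[OF q])
      have "norm (t n u) \<le> norm (norm (q u) * exp (b * \<bar>u\<bar>))" for u
      proof -
        have "norm (t n u) \<le> (\<Sum>i<Suc n. norm (t i u))"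
          by (rule member_le_sum) auto
        also have "\<dots> \<le> norm (q u) * exp (b * \<bar>u\<bar>)" by (rule partial)
        finally show ?thesis by simp
      qed
      then show "AE u in lborel. norm (t n u) \<le> norm (norm (q u) * exp (b * \<bar>u\<bar>))" by simp
    qed simp
    have "summable (\<lambda>n. LINT u|lborel. norm (t n u))"
    proof (rule bounded_imp_summable)
      fix n
      have "(\<Sum>k\<le>n. (LINT u|lborel. norm (t k u))) = (LINT u|lborel. (\<Sum>k\<le>n. norm (t k u)))"
        using int_t by (subst Bochner_Integration.integral_sum) auto
      also have "\<dots> \<le> (LINT u|lborel. norm (q u) * exp (b * \<bar>u\<bar>))"
        using int_t partial[where n="Suc n"]
        by (intro integral_mono q) (auto simp: lessThan_Suc_atMost)
      finally show "(\<Sum>k\<le>n. (LINT u|lborel. norm (t k u))) \<le> (LINT u|lborel. norm (q u) * exp (b * \<bar>u\<bar>))" .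
    qed simp
    from sums_integral[OF int_t _ this]
    have "(\<lambda>n. LINT u|lborel. t n u) sums (LINT u|lborel. (\<Sum>n. t n u))"
      using sums_summable[OF sums_norm] by simp
    moreover have "(\<Sum>n. t n u) = q u * exp (- (\<i> * (complex_of_real u * w)))" for u
      using sums_unique[OF sums_t] by simp
    moreover have "(LINT u|lborel. t n u) = (LINT u|lborel. q u * exp (- (\<i> * (complex_of_real u * z))) *
        ((- (\<i> * complex_of_real u)) ^ n /\<^sub>R fact n)) * (w - z) ^ n" for n
      unfolding t_def by (rule integral_mult_left_zero)
    ultimately show "(\<lambda>n. (LINT u|lborel. q u * exp (- (\<i> * (complex_of_real u * z))) *
        ((- (\<i> * complex_of_real u)) ^ n /\<^sub>R fact n)) * (w - z) ^ n) sums ?F w"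
      by simp
  qed
  have "?F field_differentiable at z" if "\<bar>Im z\<bar> < b" for z
    using loc[of z] that by (intro holomorphic_on_imp_differentiable_at[of _ "ball z (b - \<bar>Im z\<bar>)"]) auto
  then show ?thesis by (simp add: holomorphic_on_def field_differentiable_at_within)
qed

section \<open>Exponential substitution, folding and uniqueness\<close>

text \<open>Change of variables along \<open>exp\<close>, a bijection of the line onto the positive
  half-line with derivative \<open>exp\<close>. The detour through absolute integrability over
  \<open>lebesgue\<close> matches that rule.\<close>

lemma exp_substitution:
  fixes u :: "real \<Rightarrow> real"
  assumes u: "integrable lborel u"
  shows "integrable lborel (\<lambda>x. u (exp x) * exp x)"
    and "(LINT x|lborel. u (exp x) * exp x) = (LINT x|lborel. indicator {0<..} x * u x)"
proof -
  have m[measurable]: "u \<in> borel_measurable borel" using borel_measurable_integrable[OF u] by simp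
  have "integrable lborel (\<lambda>x. indicator {0<..} x *\<^sub>R u x)"
    using u by (intro integrable_mult_indicator) auto
  then have "integrable lebesgue (\<lambda>x. indicator {0<..} x *\<^sub>R u x)"
    by (subst integrable_completion) auto
  then have abs: "u absolutely_integrable_on {0<..}" by (simp add: set_integrable_def)
  have range: "exp ` (UNIV :: real set) = {0<..}"
    by (auto simp: image_iff intro: exI[of _ "ln _"] exp_ln[symmetric])
  have "(\<lambda>x. \<bar>exp x\<bar> * u (exp x)) absolutely_integrable_on UNIV \<and>
      integral UNIV (\<lambda>x. \<bar>exp x\<bar> * u (exp x)) = integral {0<..} u"
    using has_absolute_integral_change_of_variables_1'[of UNIV exp exp u "integral {0<..} u"] abs range
    by (auto simp: inj_on_def intro: DERIV_exp)
  then have ai: "(\<lambda>x. u (exp x) * exp x) absolutely_integrable_on UNIV"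
    and ii: "integral UNIV (\<lambda>x. u (exp x) * exp x) = integral {0<..} u"
    by (simp_all add: mult.commute)
  from ai have "integrable lebesgue (\<lambda>x. u (exp x) * exp x)" by (simp add: set_integrable_def)
  then show int: "integrable lborel (\<lambda>x. u (exp x) * exp x)"
    by (subst (asm) integrable_completion) auto
  have "integral {0<..} u = (LINT x:{0<..}|lebesgue. u x)"
    using set_lebesgue_integral_eq_integral(2)[OF abs] by simp
  also have "\<dots> = (LINT x|lborel. indicator {0<..} x * u x)"
    unfolding set_lebesgue_integral_def by (subst integral_completion) auto
  finally show "(LINT x|lborel. u (exp x) * exp x) = (LINT x|lborel. indicator {0<..} x * u x)"
    using integral_lborel[OF int] ii by simp
qed

text \<open>The line is split at the origin, a null set, and the negative half is reflected. This is
  how the sum of the wavelet spectrum at opposite frequencies arises.\<close>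

lemma integral_fold_half_line:
  fixes u :: "real \<Rightarrow> real"
  assumes u: "integrable lborel u"
  shows "(LINT x|lborel. u x) = (LINT x|lborel. indicator {0<..} x * (u x + u (- x)))"
proof -
  have m[measurable]: "u \<in> borel_measurable borel" using borel_measurable_integrable[OF u] by simp
  have i: "integrable lborel (\<lambda>x. indicator A x * v x)"
    if "integrable lborel v" "A \<in> sets borel" for A :: "real set" and v :: "real \<Rightarrow> real"
    using integrable_mult_indicator[of A lborel v] that by simp
  have u': "integrable lborel (\<lambda>x. u (- x))"
    using lborel_integrable_real_affine[OF u, of "-1" 0] by simp
  have "(LINT x|lborel. u x) = (LINT x|lborel. indicator {0<..} x * u x + indicator {..<0} x * u x)"
  proof (rule integral_cong_AE)
    show "AE x in lborel. u x = indicator {0<..} x * u x + indicator {..<0} x * u x"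
      using AE_lborel_singleton[of 0] by eventually_elim (auto simp: indicator_def)
  qed auto
  also have "\<dots> = (LINT x|lborel. indicator {0<..} x * u x) + (LINT x|lborel. indicator {..<0} x * u x)"
    by (intro Bochner_Integration.integral_add i u) auto
  also have "(LINT x|lborel. indicator {..<0} x * u x) = (LINT x|lborel. indicator {..<0} (- x) * u (- x))"
    by (subst lborel_integral_real_affine[where c="-1" and t=0]) auto
  also have "\<dots> = (LINT x|lborel. indicator {0<..} x * u (- x))"
    by (intro Bochner_Integration.integral_cong) (auto simp: indicator_def)
  also have "(LINT x|lborel. indicator {0<..} x * u x) + \<dots> =
      (LINT x|lborel. indicator {0<..} x * u x + indicator {0<..} x * u (- x))"
    by (intro Bochner_Integration.integral_add[symmetric] i u u') auto
  finally show ?thesis by (simp add: distrib_left)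
qed

lemma integrable_exp_neg_abs:
  fixes c :: real
  assumes c: "c > 0"
  shows "integrable lborel (\<lambda>x. exp (- (c * \<bar>x\<bar>)))"
proof -
  have p: "integrable lborel (\<lambda>x. indicator {0<..} x * exp (- (x * c)) :: real)"
    using integrable_I0i_exp_mscale[OF c] by (simp add: set_integrable_def)
  have n: "integrable lborel (\<lambda>x. indicator {0<..} (- x) * exp (- (- x * c)) :: real)"
    using lborel_integrable_real_affine[OF p, of "-1" 0] by simp
  show ?thesis
  proof (rule Bochner_Integration.integrable_cong_AE_imp[OF Bochner_Integration.integrable_add[OF p n]])
    show "AE x in lborel. indicator {0<..} x * exp (- (x * c)) + indicator {0<..} (- x) * exp (- (- x * c)) = exp (- (c * \<bar>x\<bar>))"
      using AE_lborel_singleton[of 0] by eventually_elim (auto simp: indicator_def abs_if mult.commute)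
  qed simp
qed

text \<open>The set where \<open>f\<close> is nonzero is open; if nonempty, it contains an interval
  of positive measure.\<close>

lemma AE_eq_0_imp_eq_0:
  fixes f :: "real \<Rightarrow> 'b::euclidean_space"
  assumes c: "continuous_on UNIV f" and ae: "AE x in lborel. f x = 0"
  shows "f x = 0"
proof (rule ccontr)
  assume "f x \<noteq> 0"
  have "open (f -` (- {0}))" by (rule open_vimage[OF _ c]) (rule open_Compl, rule closed_singleton)
  then have op: "open {x. f x \<noteq> 0}" by (simp add: vimage_def)
  then obtain e where e: "e > 0" "ball x e \<subseteq> {x. f x \<noteq> 0}"
    using \<open>f x \<noteq> 0\<close> open_contains_ball_eq by blast
  have "{x. f x \<noteq> 0} \<in> sets lborel" using op by simp
  then have "{x. f x \<noteq> 0} \<in> null_sets lborel"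
    using ae AE_iff_null[of lborel "\<lambda>x. f x = 0"] by simp
  then have "ball x e \<in> null_sets lborel" by (rule null_sets_subset) (use e(2) in auto)
  then have "emeasure lborel {x - e<..<x + e} = 0" by (simp add: ball_eq_greaterThanLessThan null_sets_def)
  then show False using e(1) by simp
qed

lemma multiplicative_convolution_eq_0_imp_eq_0:
  fixes h \<phi> :: "real \<Rightarrow> real"
  assumes h: "continuous_on UNIV h" "integrable lborel h" "\<And>x. \<bar>h x\<bar> \<le> B"
    and \<phi>: "continuous_on UNIV \<phi>" "\<And>x. \<bar>\<phi> x\<bar> \<le> C" "\<And>x. x > R \<Longrightarrow> \<phi> x = 0"
    and \<phi>_nz: "\<omega>\<^sub>0 > 0" "\<phi> \<omega>\<^sub>0 \<noteq> 0"
    and zero: "\<And>s. s > 0 \<Longrightarrow> (LINT x|lborel. indicator {0<..} x * (h x * \<phi> (x / s))) = 0"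
    and \<omega>: "\<omega> > 0"
  shows "h \<omega> = 0"
proof -
  have [measurable]: "h \<in> borel_measurable borel" "\<phi> \<in> borel_measurable borel"
    using h(1) \<phi>(1) by (auto intro: borel_measurable_continuous_onI)
  \<comment> \<open>The transforms of \<open>H\<close> and \<open>Q\<close> at \<open>\<tau>\<close>
    are the Mellin transforms of \<open>h\<close> at \<open>1/2 - i \<tau>\<close> and of
    \<open>\<phi>\<close> at \<open>1/2 + i \<tau>\<close>.\<close>
  define H where "H x = complex_of_real (h (exp x) * exp (x / 2))" for x
  define Q where "Q y = complex_of_real (\<phi> (exp (- y)) * exp (- y / 2))" for y
  have [measurable]: "H \<in> borel_measurable borel" "Q \<in> borel_measurable borel"
    unfolding H_def Q_def by simp_all
  have H_cont: "continuous_on UNIV H" unfolding H_def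
    by (intro continuous_intros continuous_on_compose2[OF h(1)]) auto
  have Q_cont: "continuous_on UNIV Q" unfolding Q_def
    by (intro continuous_intros continuous_on_compose2[OF \<phi>(1)]) auto
  have H_int: "integrable lborel H"
  proof (rule Bochner_Integration.integrable_bound)
    \<comment> \<open>The first summand is for \<open>x \<le> 0\<close>, where \<open>h\<close> is
      bounded; the second is for \<open>x > 0\<close>, where
      \<open>exp (x / 2) \<le> exp x\<close>.\<close>
    show "integrable lborel (\<lambda>x. B * exp (- (1/2 * \<bar>x\<bar>)) + \<bar>h (exp x) * exp x\<bar>)"
      using exp_substitution(1)[OF h(2)] integrable_exp_neg_abs[of "1/2"] by auto
    have H_le: "norm (H x) \<le> B * exp (- (1/2 * \<bar>x\<bar>)) + \<bar>h (exp x) * exp x\<bar>" for x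
    proof (cases "x \<le> 0")
      case True
      have "norm (H x) = \<bar>h (exp x)\<bar> * exp (x / 2)" by (simp add: H_def norm_mult)
      also have "\<dots> \<le> B * exp (x / 2)" by (intro mult_right_mono h) simp
      also have "\<dots> = B * exp (- (1/2 * \<bar>x\<bar>))" using True by simp
      finally show ?thesis by simp
    next
      case False
      have "B \<ge> 0" using h(3)[of 0] by simp
      have "norm (H x) = \<bar>h (exp x)\<bar> * exp (x / 2)" by (simp add: H_def norm_mult)
      also have "\<dots> \<le> \<bar>h (exp x)\<bar> * exp x" using False by (intro mult_left_mono) auto
      also have "\<dots> = \<bar>h (exp x) * exp x\<bar>" by (simp add: abs_mult)
      finally show ?thesis using \<open>B \<ge> 0\<close> by (intro add_increasing) auto
    qed
    show "AE x in lborel. norm (H x) \<le> norm (B * exp (- (1/2 * \<bar>x\<bar>)) + \<bar>h (exp x) * exp x\<bar>)"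
      unfolding real_norm_def by (intro AE_I2 order_trans[OF H_le abs_ge_self])
  qed simp
  \<comment> \<open>\<open>r\<close> is nonnegative and, by \<open>- u < exp (- u)\<close>, bounds
    \<open>- u\<close> wherever \<open>Q\<close> can be nonzero; this avoids the logarithm of a
    possibly nonpositive \<open>R\<close>.\<close>
  define r where "r = max 0 R"
  have "C \<ge> 0" using \<phi>(2)[of 0] by simp
  \<comment> \<open>The rate 1/4 is half of the decay rate 1/2 of \<open>Q\<close> at plus infinity.
    It becomes the half-width of the strip and leaves an integrable
    \<open>exp (- (1/4 * \<bar>u\<bar>))\<close>.\<close>
  have Q_bound: "norm (Q u) * exp (1/4 * \<bar>u\<bar>) \<le> C * exp r * exp (- (1/4 * \<bar>u\<bar>))" for u
  proof (cases "exp (- u) > R")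
    case True
    then show ?thesis using \<phi>(3) \<open>C \<ge> 0\<close> by (simp add: Q_def)
  next
    case False
    have "- u < exp (- u)" using exp_gt_self by blast
    then have "- u \<le> r" using False by (simp add: r_def)
    have "norm (Q u) * exp (1/4 * \<bar>u\<bar>) = \<bar>\<phi> (exp (- u))\<bar> * exp (- u / 2 + 1/4 * \<bar>u\<bar>)"
      unfolding exp_add by (simp add: Q_def norm_mult)
    \<comment> \<open>The exponents compare because
      \<open>(\<bar>u\<bar> - u) / 2 = max 0 (- u)\<close>, which is at most
      \<open>r\<close>.\<close>
    also have "\<dots> \<le> C * exp (r - 1/4 * \<bar>u\<bar>)"
      using \<open>- u \<le> r\<close> \<open>C \<ge> 0\<close> by (intro mult_mono \<phi>) (auto simp: abs_if r_def)
    also have "\<dots> = C * exp r * exp (- (1/4 * \<bar>u\<bar>))" unfolding mult.assoc exp_add[symmetric] by simp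
    finally show ?thesis .
  qed
  have Q_weight: "integrable lborel (\<lambda>u. norm (Q u) * exp (1/4 * \<bar>u\<bar>))"
  proof (rule Bochner_Integration.integrable_bound)
    show "integrable lborel (\<lambda>u. C * exp r * exp (- (1/4 * \<bar>u\<bar>)))"
      using integrable_exp_neg_abs[of "1/4"] by simp
    show "AE u in lborel. norm (norm (Q u) * exp (1/4 * \<bar>u\<bar>)) \<le> norm (C * exp r * exp (- (1/4 * \<bar>u\<bar>)))"
      using Q_bound \<open>C \<ge> 0\<close> by (intro AE_I2) simp
  qed simp
  have Q_int: "integrable lborel Q"
  proof (rule Bochner_Integration.integrable_bound[OF Q_weight])
    show "AE u in lborel. norm (Q u) \<le> norm (norm (Q u) * exp (1/4 * \<bar>u\<bar>))"
      by (intro AE_I2) (simp add: mult_le_cancel_left1)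
  qed simp
  have prod: "fourier H \<tau> * fourier Q \<tau> = 0" for \<tau>
  proof -
    have "convolve H Q t = 0" for t
    proof -
      have c: "continuous_on UNIV (\<lambda>x. \<phi> (x / exp t))"
        by (intro continuous_intros continuous_on_compose2[OF \<phi>(1)]) auto
      have int: "integrable lborel (\<lambda>x. h x * \<phi> (x / exp t))"
        using h(2) \<phi>(2) by (intro integrable_mult_bounded[where B=C]) auto
      \<comment> \<open>The half weights recombine to the Jacobian \<open>exp x\<close>, and
        \<open>Q\<close> contributes \<open>\<phi>\<close> at \<open>exp x / exp t\<close>. Up to
        the factor \<open>exp (- t / 2)\<close> this is the vanishing integral at scale
        \<open>exp t\<close>.\<close>
      have "convolve H Q t = (LINT x|lborel. complex_of_real (exp (- t / 2) * (h (exp x) * \<phi> (exp x / exp t) * exp x)))"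
      proof (subst convolve_lborel, simp, simp, rule Bochner_Integration.integral_cong)
        fix x
        have "exp (x / 2) * exp (- (t - x) / 2) = exp (- t / 2) * exp x"
          by (simp add: field_simps flip: exp_add)
        moreover have "exp (- (t - x)) = exp x / exp t" by (simp add: exp_diff)
        ultimately have "h (exp x) * exp (x / 2) * (\<phi> (exp (- (t - x))) * exp (- (t - x) / 2)) =
            exp (- t / 2) * (h (exp x) * \<phi> (exp x / exp t) * exp x)"
          by (simp add: mult_ac)
        then show "H x * Q (t - x) = complex_of_real (exp (- t / 2) * (h (exp x) * \<phi> (exp x / exp t) * exp x))"
          unfolding H_def Q_def by (metis of_real_mult)
      qed simp
      also have "\<dots> = complex_of_real (exp (- t / 2) * (LINT x|lborel. h (exp x) * \<phi> (exp x / exp t) * exp x))"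
        by (simp only: integral_complex_of_real integral_mult_right_zero)
      also have "\<dots> = 0"
        using exp_substitution(2)[OF int] zero[of "exp t"] by simp
      finally show ?thesis .
    qed
    then have "fourier (convolve H Q) \<tau> = 0" by (simp add: fourier_def)
    then show ?thesis using fourier_convolve[OF H_int Q_int] by simp
  qed
  let ?q = "\<lambda>w. LINT u|lborel. Q u * exp (- (\<i> * (complex_of_real u * w)))"
  have q_fourier: "?q (complex_of_real \<tau>) = fourier Q \<tau>" for \<tau>
    by (subst fourier_lborel) simp_all
  let ?S = "{z. \<bar>Im z\<bar> < 1/4}"
  have q_hol: "?q holomorphic_on ?S"
    by (rule holomorphic_fourier_strip[OF _ Q_weight]) simp
  have S_eq: "?S = {z. Im z < 1/4} \<inter> {z. Im z > - (1/4)}" by auto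
  have S: "open ?S" "connected ?S"
    unfolding S_eq
    by (intro open_Int open_halfspace_Im_lt open_halfspace_Im_gt)
       (intro convex_connected convex_Int convex_halfspace_Im_lt convex_halfspace_Im_gt)
  have fH: "fourier H \<tau> = 0" for \<tau>
  proof (rule ccontr)
    \<comment> \<open>By continuity the transform of \<open>H\<close> is nonzero on an interval,
      where the transform of \<open>Q\<close> must then vanish. The centre is a limit point inside
      the strip, so analytic continuation makes that transform vanish on the real line, and
      \<open>Q\<close> with it.\<close>
    assume nz: "fourier H \<tau> \<noteq> 0"
    have "open (fourier H -` (- {0}))"
      by (rule open_vimage[OF _ continuous_fourier[OF H_int]]) (rule open_Compl, rule closed_singleton)
    then have "open {x. fourier H x \<noteq> 0}" by (simp add: vimage_def)
    then obtain e where e: "e > 0" "ball \<tau> e \<subseteq> {x. fourier H x \<noteq> 0}"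
      using nz open_contains_ball_eq by blast
    have fQ_ball: "fourier Q x = 0" if "x \<in> ball \<tau> e" for x
      using prod[of x] e(2) that by auto
    have "\<tau> islimpt ball \<tau> e" using e(1) by (intro interior_limit_point) simp
    then have lim: "complex_of_real \<tau> islimpt complex_of_real ` ball \<tau> e"
      unfolding islimpt_approachable by (force simp: dist_of_real)
    have "fourier Q x = 0" for x
    proof -
      have "?q (complex_of_real x) = 0"
      proof (rule analytic_continuation[OF q_hol S _ _ lim])
        fix z assume "z \<in> complex_of_real ` ball \<tau> e"
        then obtain y where y: "y \<in> ball \<tau> e" and z: "z = complex_of_real y" by blast
        show "?q z = 0" unfolding z q_fourier by (rule fQ_ball[OF y])
      qed auto
      then show ?thesis by (simp only: q_fourier)
    qed
    then have "AE x in lborel. Q x = 0" by (rule fourier_eq_0_imp_AE_eq_0[OF Q_int])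
    \<comment> \<open>At this point \<open>Q\<close> is a positive multiple of
      \<open>\<phi> \<omega>\<^sub>0\<close>, which contradicts the choice of
      \<open>\<omega>\<^sub>0\<close>.\<close>
    then have "Q (- ln \<omega>\<^sub>0) = 0" by (rule AE_eq_0_imp_eq_0[OF Q_cont])
    then show False using \<phi>_nz by (simp add: Q_def)
  qed
  then have "AE x in lborel. H x = 0" by (rule fourier_eq_0_imp_AE_eq_0[OF H_int])
  then have "H (ln \<omega>) = 0" by (rule AE_eq_0_imp_eq_0[OF H_cont])
  then show ?thesis using \<omega> by (simp add: H_def)
qed

theorem theorem2p4:
  fixes f g :: "real \<Rightarrow> real" and \<psi> :: "real \<Rightarrow> complex"
  assumes "L1_L2 f" and "L1_L2 g"
    and "wavelet \<psi>"
    and "linear_independence_condition \<psi>"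
    and "compact (closure {\<omega>. fourier \<psi> \<omega> \<noteq> 0})"
  shows "(\<forall>s>0. wavelet_invariant \<psi> (\<lambda>x. complex_of_real (f x)) s
                = wavelet_invariant \<psi> (\<lambda>x. complex_of_real (g x)) s)
    \<longleftrightarrow> (AE \<omega> in lebesgue. power_spectrum (\<lambda>x. complex_of_real (f x)) \<omega>
                          = power_spectrum (\<lambda>x. complex_of_real (g x)) \<omega>)"
proof -
  let ?Pf = "power_spectrum (\<lambda>x. complex_of_real (f x))"
  let ?Pg = "power_spectrum (\<lambda>x. complex_of_real (g x))"
  let ?P = "power_spectrum \<psi>"
  have F: "L1_L2 (\<lambda>x. complex_of_real (f x))" and G: "L1_L2 (\<lambda>x. complex_of_real (g x))"
    using assms(1,2) by (auto simp: L1_L2_def)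
  have \<psi>: "L1_L2 \<psi>" using assms(3) by (simp add: wavelet_def)
  note cont = continuous_power_spectrum[OF F] continuous_power_spectrum[OF G] continuous_power_spectrum[OF \<psi>]
  have [measurable]: "?Pf \<in> borel_measurable borel" "?Pg \<in> borel_measurable borel" "?P \<in> borel_measurable borel"
    using cont by (auto intro: borel_measurable_continuous_onI)
  note inv = wavelet_invariant_eq[OF F \<psi>] wavelet_invariant_eq[OF G \<psi>]
  obtain Bf Bg C where B: "?Pf \<omega> \<le> Bf" "?Pg \<omega> \<le> Bg" "?P \<omega> \<le> C" for \<omega>
    using power_spectrum_bounded F G \<psi> by metis
  have nn: "power_spectrum k \<omega> \<ge> 0" for k \<omega> by (simp add: power_spectrum_def)
  show ?thesis
  proof
    assume "AE \<omega> in lebesgue. ?Pf \<omega> = ?Pg \<omega>"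
    then have ae: "AE \<omega> in lborel. ?Pf \<omega> = ?Pg \<omega>" by (simp add: AE_completion_iff)
    show "\<forall>s>0. wavelet_invariant \<psi> (\<lambda>x. complex_of_real (f x)) s = wavelet_invariant \<psi> (\<lambda>x. complex_of_real (g x)) s"
    proof (intro allI impI)
      fix s :: real assume s: "s > 0"
      have "(LINT \<omega>|lborel. ?Pf \<omega> * ?P (\<omega> / s)) = (LINT \<omega>|lborel. ?Pg \<omega> * ?P (\<omega> / s))"
      proof (rule integral_cong_AE)
        show "AE \<omega> in lborel. ?Pf \<omega> * ?P (\<omega> / s) = ?Pg \<omega> * ?P (\<omega> / s)"
          using ae by eventually_elim simp
      qed auto
      then show "wavelet_invariant \<psi> (\<lambda>x. complex_of_real (f x)) s = wavelet_invariant \<psi> (\<lambda>x. complex_of_real (g x)) s"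
        using inv s by simp
    qed
  next
    assume eq: "\<forall>s>0. wavelet_invariant \<psi> (\<lambda>x. complex_of_real (f x)) s = wavelet_invariant \<psi> (\<lambda>x. complex_of_real (g x)) s"
    define h where "h \<omega> = ?Pf \<omega> - ?Pg \<omega>" for \<omega>
    define \<phi> where "\<phi> \<omega> = ?P \<omega> + ?P (- \<omega>)" for \<omega>
    have h_even: "h (- \<omega>) = h \<omega>" for \<omega> by (simp add: h_def power_spectrum_even)
    have h_cont: "continuous_on UNIV h" unfolding h_def by (intro continuous_intros cont)
    have h_int: "integrable lborel h"
      unfolding h_def by (intro Bochner_Integration.integrable_diff integrable_power_spectrum F G)
    have h_bound: "\<bar>h \<omega>\<bar> \<le> Bf + Bg" for \<omega>
      using B(1,2)[of \<omega>] nn[of _ \<omega>] unfolding h_def by (smt (verit))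
    have \<phi>_cont: "continuous_on UNIV \<phi>"
      unfolding \<phi>_def by (intro continuous_intros cont continuous_on_compose2[OF cont(3)]) auto
    have \<phi>_bound: "\<bar>\<phi> \<omega>\<bar> \<le> 2 * C" for \<omega>
      using B(3)[of \<omega>] B(3)[of "- \<omega>"] nn[of \<psi> \<omega>] nn[of \<psi> "- \<omega>"] unfolding \<phi>_def by linarith
    obtain R where R: "\<And>x. x \<in> closure {\<omega>. fourier \<psi> \<omega> \<noteq> 0} \<Longrightarrow> norm x \<le> R"
      using compact_imp_bounded[OF assms(5)] unfolding bounded_iff by blast
    have P_supp: "?P x = 0" if "\<bar>x\<bar> > R" for x
    proof (rule ccontr)
      assume "?P x \<noteq> 0"
      then have "x \<in> {\<omega>. fourier \<psi> \<omega> \<noteq> 0}" by (auto simp: power_spectrum_def)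
      then have "norm x \<le> R" by (intro R subsetD[OF closure_subset])
      then show False using that by simp
    qed
    have \<phi>_supp: "\<phi> x = 0" if "x > R" for x
      using P_supp[of x] P_supp[of "- x"] that unfolding \<phi>_def by simp
    have "\<exists>\<omega>\<^sub>0>0. \<phi> \<omega>\<^sub>0 \<noteq> 0"
    \<comment> \<open>If \<open>\<phi>\<close> vanished on the positive half-line, so would the
      folded spectrum at frequency 1, which equals \<open>\<phi> (1 / s) / s\<close> at scale
      \<open>s\<close>. A single zero function is linearly dependent.\<close>
    proof (rule ccontr)
      assume "\<not> (\<exists>\<omega>\<^sub>0>0. \<phi> \<omega>\<^sub>0 \<noteq> 0)"
      then have z: "\<phi> x = 0" if "x > 0" for x using that by blast
      have fold0: "folded_spectrum \<psi> s 1 = 0" if s: "s > 0" for s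
      proof -
        have "folded_spectrum \<psi> s 1 = \<phi> (1 / s) / s"
          by (simp add: folded_spectrum_def \<phi>_def power_spectrum_dilate[OF \<psi> s] add_divide_distrib)
        then show ?thesis using z[of "1 / s"] s by simp
      qed
      \<comment> \<open>The instances are, in order, the constant frequency 1, the length 1, the
        constant coefficient 1 and the index 0.\<close>
      have "(1::real) = 0"
        using assms(4)[unfolded linear_independence_condition_def, rule_format,
            of "\<lambda>_. 1" 1 "\<lambda>_. 1" 0] fold0 by (simp add: inj_on_def)
      then show False by simp
    qed
    then obtain \<omega>\<^sub>0 where \<omega>\<^sub>0: "\<omega>\<^sub>0 > 0" "\<phi> \<omega>\<^sub>0 \<noteq> 0" by blast
    have zero: "(LINT x|lborel. indicator {0<..} x * (h x * \<phi> (x / s))) = 0" if s: "s > 0" for s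
    proof -
      have Ps: "(\<lambda>\<omega>. ?P (\<omega> / s)) \<in> borel_measurable lborel" "\<And>\<omega>. norm (?P (\<omega> / s)) \<le> C"
        using B(3) nn by auto
      have i: "integrable lborel (\<lambda>\<omega>. ?Pf \<omega> * ?P (\<omega> / s))" "integrable lborel (\<lambda>\<omega>. ?Pg \<omega> * ?P (\<omega> / s))"
        "integrable lborel (\<lambda>\<omega>. h \<omega> * ?P (\<omega> / s))"
        by (rule integrable_mult_bounded[OF _ Ps]; intro integrable_power_spectrum F G h_int)+
      have "(LINT \<omega>|lborel. ?Pf \<omega> * ?P (\<omega> / s)) = (LINT \<omega>|lborel. ?Pg \<omega> * ?P (\<omega> / s))"
        using eq inv s by simp
      then have h0: "(LINT \<omega>|lborel. h \<omega> * ?P (\<omega> / s)) = 0"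
        using Bochner_Integration.integral_diff[OF i(1,2)] by (simp add: h_def left_diff_distrib)
      \<comment> \<open>Since \<open>h\<close> is even, the two reflected terms share the factor
        \<open>h x\<close>, and the spectra of the wavelet add up to \<open>\<phi>\<close>.\<close>
      have fold: "indicator {0<..} x * (h x * ?P (x / s) + h (- x) * ?P (- x / s)) =
          indicator {0<..} x * (h x * \<phi> (x / s))" for x :: real
        by (simp add: h_even \<phi>_def distrib_left)
      show ?thesis using h0 unfolding integral_fold_half_line[OF i(3)] fold .
    qed
    have pos: "h \<omega> = 0" if "\<omega> > 0" for \<omega>
      by (rule multiplicative_convolution_eq_0_imp_eq_0[OF h_cont h_int h_bound \<phi>_cont \<phi>_bound \<phi>_supp \<omega>\<^sub>0 zero that])
    \<comment> \<open>Evenness carries the result to negative frequencies; the origin is discarded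
      as a null set.\<close>
    have "AE \<omega> in lborel. h \<omega> = 0"
      using AE_lborel_singleton[of 0]
    proof eventually_elim
      case (elim \<omega>)
      then show ?case using pos[of \<omega>] pos[of "- \<omega>"] h_even[of \<omega>] by (cases "\<omega> > 0") auto
    qed
    then have "AE \<omega> in lebesgue. h \<omega> = 0" by (rule AE_completion)
    then show "AE \<omega> in lebesgue. ?Pf \<omega> = ?Pg \<omega>" by (simp add: h_def)
  qed
qed

end
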